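(* Let $n,r\ge 1$, let $v_1,\ldots,v_r\in\mathbb{Z}^n$ satisfy $\sum_{i=1}^r v_i=0$, and let $\mathbf{a}=(a_1,\ldots,a_r)\in\mathbb{Z}^r$. Suppose $P=\bigcap_{i=1}^r\{x\in\mathbb{R}^n : \langle v_i,x\rangle+a_i\ge 0\}$ is compact and each hyperplane $H_i=\{x : \langle v_i,x\rangle+a_i=0\}$ meets $P$. For each integer $k\ge 1$ let $\mathbf{X}_{k\mathbf{a}}$ be the polyhedral multinomial random vector associated to $k\mathbf{a}$, and let $\mathbf{Y}_k=\frac{\mathbf{X}_{k\mathbf{a}}-\mathbb{E}[\mathbf{X}_{k\mathbf{a}}]}{\sqrt{k}}$. Then $\mathbf{Y}_k$ converges weakly (in distribution) as $k\to\infty$ to the probability measure on $\mathbb{R}^n$ supported on $L$ given by \[ \frac{e^{-\frac{1}{2}Q(x)}\,\lambda_L(dx)}{\int_L e^{-\frac{1}{2}Q(x)}\,\lambda_L(dx)},\qquad Q(x)=\sum_{i\in I_{\mathbf{a}}}\frac{\langle v_i,x\rangle^2}{\langle v_i,m_{\mathbf{a}}\rangle+a_i}, \] where $\lambda_L$ denotes Lebesgue measure on the linear subspace $L$; i.e. a centered Gaussian on $L$ whose density is proportional to $e^{-Q(x)/2}$.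
   Context: For an integer vector $\mathbf{b}=(b_1,\ldots,b_r)$ (here $\mathbf{b}=k\mathbf{a}$, so the polyhedron is $kP$), the polyhedral multinomial random vector $\mathbf{X}_{\mathbf{b}}$ takes values in the lattice points $x$ of $\bigcap_i\{\langle v_i,x\rangle+b_i\ge 0\}$, with $\mathbb{P}(\mathbf{X}_{\mathbf{b}}=x)=\frac{1}{Z}\binom{|\mathbf{b}|}{\langle v_1,x\rangle+b_1,\ldots,\langle v_r,x\rangle+b_r}$, where $|\mathbf{b}|=\sum_i b_i$ (which equals $\sum_i(\langle v_i,x\rangle+b_i)$ since $\sum_i v_i=0$), the multinomial coefficient is $|\mathbf{b}|!/\prod_i(\langle v_i,x\rangle+b_i)!$, and $Z$ is the normalizing constant. $L\subset\mathbb{R}^n$ is the linear subspace spanned by all differences $y-z$ with $y,z\in P$. $I_{\mathbf{a}}\subset\{1,\ldots,r\}$ is the set of indices $i$ for which $x\mapsto\langle v_i,x\rangle$ is not constant on $P$. The potential $\phi_{\mathbf{a}}:P\to\mathbb{R}_{>0}$ is $\phi_{\mathbf{a}}(x)=\prod_{i=1}^r(\langle v_i,x\rangle+a_i)^{\langle v_i,x\rangle+a_i}$ with the convention $0^0=1$; $m_{\mathbf{a}}$ is the unique minimizer of $\phi_{\mathbf{a}}$ on $P$, which lies in the relative interior of $P$ (the interior of $P$ within its affine span), so $\langle v_i,m_{\mathbf{a}}\rangle+a_i>0$ for $i\in I_{\mathbf{a}}$.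
   Formalization: The formal theorem also assumes that kP contains a lattice point for every k ≥ 1, so that each X_{ka} is defined; otherwise Z = 0 can occur, e.g. n=1, v=(2,-2), a=(1,-1), where P={-1/2} and kP has no lattice point for odd k. *)

theory Defs
  imports "HOL-Probability.Probability"
begin

definition polyhedron :: "nat \<Rightarrow> (nat \<Rightarrow> real^'n) \<Rightarrow> (nat \<Rightarrow> int) \<Rightarrow> (real^'n) set" where
  "polyhedron r v b = {x. \<forall>i<r. v i \<bullet> x + of_int (b i) \<ge> 0}"

definition pm_support :: "nat \<Rightarrow> (nat \<Rightarrow> real^'n) \<Rightarrow> (nat \<Rightarrow> int) \<Rightarrow> (real^'n) set" where
  "pm_support r v b = {x \<in> polyhedron r v b. \<forall>j. x $ j \<in> \<int>}"

text \<open>Multinomial weight |b|! / prod_i (<v_i,x> + b_i)! (the entries are nonnegative integers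
  on the support).\<close>
definition pm_weight :: "nat \<Rightarrow> (nat \<Rightarrow> real^'n) \<Rightarrow> (nat \<Rightarrow> int) \<Rightarrow> real^'n \<Rightarrow> real" where
  "pm_weight r v b x =
     fact (nat (\<Sum>i<r. b i)) / (\<Prod>i<r. fact (nat \<lfloor>v i \<bullet> x + of_int (b i)\<rfloor>))"

definition pm_pmf :: "nat \<Rightarrow> (nat \<Rightarrow> real^'n) \<Rightarrow> (nat \<Rightarrow> int) \<Rightarrow> (real^'n) pmf" where
  "pm_pmf r v b = embed_pmf (\<lambda>x. if x \<in> pm_support r v b
       then pm_weight r v b x / (\<Sum>y\<in>pm_support r v b. pm_weight r v b y) else 0)"

definition selfpow :: "real \<Rightarrow> real" where
  "selfpow y = (if y = 0 then 1 else y powr y)"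

definition potential :: "nat \<Rightarrow> (nat \<Rightarrow> real^'n) \<Rightarrow> (nat \<Rightarrow> int) \<Rightarrow> real^'n \<Rightarrow> real" where
  "potential r v a x = (\<Prod>i<r. selfpow (v i \<bullet> x + of_int (a i)))"

definition min_point :: "nat \<Rightarrow> (nat \<Rightarrow> real^'n) \<Rightarrow> (nat \<Rightarrow> int) \<Rightarrow> real^'n" where
  "min_point r v a = (THE m. m \<in> polyhedron r v a \<and>
      (\<forall>x\<in>polyhedron r v a. potential r v a m \<le> potential r v a x))"

definition nonconst_idx :: "nat \<Rightarrow> (nat \<Rightarrow> real^'n) \<Rightarrow> (nat \<Rightarrow> int) \<Rightarrow> nat set" where
  "nonconst_idx r v a = {i. i < r \<and>
     (\<exists>x\<in>polyhedron r v a. \<exists>y\<in>polyhedron r v a. v i \<bullet> x \<noteq> v i \<bullet> y)}"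

definition diff_space :: "('a::real_vector) set \<Rightarrow> 'a set" where
  "diff_space P = span {y - z | y z. y \<in> P \<and> z \<in> P}"

definition Qform :: "nat \<Rightarrow> (nat \<Rightarrow> real^'n) \<Rightarrow> (nat \<Rightarrow> int) \<Rightarrow> real^'n \<Rightarrow> real" where
  "Qform r v a x = (\<Sum>i\<in>nonconst_idx r v a.
      (v i \<bullet> x)^2 / (v i \<bullet> min_point r v a + of_int (a i)))"

text \<open>Lebesgue measure on a linear subspace L: push-forward of Lebesgue measure on R^d
  along an orthonormal basis of L (independent of the choice of orthonormal basis).\<close>
definition subspace_lebesgue :: "('a::euclidean_space) set \<Rightarrow> 'a measure" where
  "subspace_lebesgue L = (let bs = (SOME bs. distinct bs \<and> pairwise orthogonal (set bs) \<and>
        (\<forall>b\<in>set bs. norm b = 1) \<and> span (set bs) = L)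
     in distr (Pi\<^sub>M {..<length bs} (\<lambda>_. lborel)) borel (\<lambda>t. \<Sum>j<length bs. t j *\<^sub>R bs ! j))"

definition weak_conv_meas :: "(nat \<Rightarrow> ('a::topological_space) measure) \<Rightarrow> 'a measure \<Rightarrow> bool" where
  "weak_conv_meas \<mu>s \<mu> \<longleftrightarrow> (\<forall>f :: 'a \<Rightarrow> real. continuous_on UNIV f \<longrightarrow> bounded (range f) \<longrightarrow>
      (\<lambda>k. integral\<^sup>L (\<mu>s k) f) \<longlonglongrightarrow> integral\<^sup>L \<mu> f)"

definition gauss_limit :: "nat \<Rightarrow> (nat \<Rightarrow> real^'n) \<Rightarrow> (nat \<Rightarrow> int) \<Rightarrow> (real^'n) measure" where
  "gauss_limit r v a = (let lamL = subspace_lebesgue (diff_space (polyhedron r v a));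
       Z = integral\<^sup>L lamL (\<lambda>x. exp (- Qform r v a x / 2))
     in density lamL (\<lambda>x. ennreal (exp (- Qform r v a x / 2) / Z)))"

end

(* Let lam_i = <v_i, m> + a_i at the minimizer m.  Stationarity of the potential along L says
   Sum_{i in I} <v_i, y> ln lam_i = 0 for y in L, hence prod_{i in I} (k lam_i)^(N_i) does not depend
   on the lattice point x, where N_i = <v_i, x> + k a_i.  Therefore P(X = x) is proportional to the
   product over i in I of the Poisson(k lam_i) probabilities of N_i.  Each factor has a Gaussian local
   limit in (N_i - k lam_i) / sqrt(k lam_i) = <v_i, y> / sqrt(lam_i), with y = (x - k m) / sqrt k, and
   exponential tails in this variable, so sums over the lattice points are Riemann sums to which
   dominated convergence on L applies.  The limit of (X - k m) / sqrt k is symmetric, and the same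
   domination gives convergence of the means, so recentring at the mean changes nothing. *)
theory Submission
  imports Defs
begin

section \<open>Local limit of Poisson probabilities\<close>

text \<open>Factors common to all weights cancel in a quotient of two sums, and the proof is
  arranged around this. Poisson probabilities are needed only relative to the mode, so no asymptotic
  constant for factorials has to be found. The volume of the lattice cell and the multiplicity with
  which its translates cover \<open>L\<close> cancel as well. Weak convergence alone would not give
  the means, because the identity is unbounded. The limit is therefore proved for test functions of
  linear growth, with values in a Banach space, that may vary with \<open>k\<close>: the identity
  yields the means, and \<open>f (y - c k)\<close> with a null sequence \<open>c\<close> yields the
  recentred statement. The support moves with \<open>k\<close>, but after subtracting
  \<open>k\<close> times one fixed integer point of \<open>P\<close> it lies in a single lattice.
  This lattice spans \<open>L\<close> because \<open>L\<close> is cut out by equations with integer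
  coefficients, namely those of the indices outside \<open>I\<close>.\<close>

text \<open>Poisson point probabilities with mean \<open>\<mu>\<close>, divided by the one at the mode: this quotient has a
  local limit that does not involve Stirling's constant.\<close>
definition pois_ratio :: "real \<Rightarrow> nat \<Rightarrow> real" where
  "pois_ratio \<mu> n = \<mu> ^ n * fact (nat \<lfloor>\<mu>\<rfloor>) / (\<mu> ^ nat \<lfloor>\<mu>\<rfloor> * fact n)"

lemma pois_ratio_pos: "\<mu> > 0 \<Longrightarrow> pois_ratio \<mu> n > 0"
  by (simp add: pois_ratio_def)

lemma pois_ratio_Suc: "pois_ratio \<mu> (Suc n) = pois_ratio \<mu> n * (\<mu> / real (Suc n))"
  by (simp add: pois_ratio_def field_simps)

lemma pois_ratio_floor: "\<mu> > 0 \<Longrightarrow> pois_ratio \<mu> (nat \<lfloor>\<mu>\<rfloor>) = 1"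
  by (simp add: pois_ratio_def)

section \<open>Exponential tails of the Poisson ratios\<close>

lemma half_diff_nonneg: "x \<le> c \<Longrightarrow> 0 \<le> 1/2 * (c - x)" for x c :: real
  by simp

text \<open>Consecutive ratios are \<mu> / (n+1). Above the mode they are at most 1, and beyond one
  standard deviation they are at most 1 / (1 + h) with h = 1 / sqrt \<mu>, which is geometric decay
  on the scale of the standard deviation. Within one standard deviation the exponent is nonnegative,
  so the bound 1, carried along in the induction, is enough there.\<close>

lemma pois_ratio_upper_tail:
  assumes \<mu>: "\<mu> \<ge> 1" and n: "nat \<lfloor>\<mu>\<rfloor> \<le> n"
  shows "pois_ratio \<mu> n \<le> 1 \<and> pois_ratio \<mu> n \<le> exp (1/2 * (1 - (real n - \<mu>) / sqrt \<mu>))"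
  using n
proof (induction n rule: dec_induct)
  case base
  have "real (nat \<lfloor>\<mu>\<rfloor>) \<le> \<mu>" using \<mu> by linarith
  then have "(real (nat \<lfloor>\<mu>\<rfloor>) - \<mu>) / sqrt \<mu> \<le> 1"
    using \<mu> by (intro order_trans[OF divide_nonpos_pos]) auto
  then have "0 \<le> 1/2 * (1 - (real (nat \<lfloor>\<mu>\<rfloor>) - \<mu>) / sqrt \<mu>)"
    by (intro half_diff_nonneg) linarith
  then have "1 \<le> exp (1/2 * (1 - (real (nat \<lfloor>\<mu>\<rfloor>) - \<mu>) / sqrt \<mu>))"
    by (simp only: one_le_exp_iff)
  moreover have "pois_ratio \<mu> (nat \<lfloor>\<mu>\<rfloor>) = 1" using \<mu> by (intro pois_ratio_floor) auto
  ultimately show ?case by (simp only: order_refl simp_thms)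
next
  case (step n)
  define h where "h = 1 / sqrt \<mu>"
  have h: "0 < h" "h \<le> 1" "\<mu> * h = sqrt \<mu>"
    using \<mu> by (auto simp: h_def real_div_sqrt)
  have n1: "\<mu> < real (Suc n)" using step \<mu> by linarith
  have le1: "\<mu> / real (Suc n) \<le> 1" using n1 \<mu> by (simp add: divide_simps)
  have 1: "pois_ratio \<mu> (Suc n) \<le> 1"
    unfolding pois_ratio_Suc
    using mult_mono[OF conjunct1[OF step(3)] le1] \<mu> by simp
  have "pois_ratio \<mu> (Suc n) \<le> exp (1/2 * (1 - (real (Suc n) - \<mu>) * h))"
  proof (cases "real (Suc n) \<ge> \<mu> + sqrt \<mu>")
    case False
    then have "(real (Suc n) - \<mu>) * h \<le> sqrt \<mu> * h"
      using h by (intro mult_right_mono) auto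
    also have "\<dots> = 1" using \<mu> by (simp add: h_def)
    finally have X: "0 \<le> 1/2 * (1 - (real (Suc n) - \<mu>) * h)" by simp
    show ?thesis using 1 X[folded one_le_exp_iff] by linarith
  next
    case True
    have "\<mu> / real (Suc n) \<le> \<mu> / (\<mu> + sqrt \<mu>)"
      using True \<mu> by (intro divide_left_mono mult_pos_pos add_pos_nonneg) auto
    also have "\<dots> = \<mu> / (\<mu> * (1 + h))" using h by (simp add: algebra_simps)
    also have "\<dots> = 1 / (1 + h)" using \<mu> by simp
    also have "\<dots> \<le> exp (- h / 2)"
    proof -
      \<comment> \<open>The rate 1/2 leaves room for the quadratic term: for h at most 1 it is
        absorbed by the remaining h/2.\<close>
      have "exp (h/2) \<le> 1 + h/2 + (h/2)^2"
        using exp_bound[of "h/2"] h by simp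
      also have "\<dots> \<le> 1 + h"
      proof -
        have "h * h \<le> 1 * h" using h by (intro mult_right_mono) auto
        moreover have "(h / 2)\<^sup>2 = h * h / 4" by (simp add: power2_eq_square)
        ultimately show ?thesis using h(1) by linarith
      qed
      finally show ?thesis using h by (simp add: exp_minus field_simps)
    qed
    finally have "\<mu> / real (Suc n) \<le> exp (- h / 2)" .
    then have "pois_ratio \<mu> (Suc n) \<le> exp (1/2 * (1 - (real n - \<mu>) * h)) * exp (- h / 2)"
      unfolding pois_ratio_Suc using step(3) \<mu> pois_ratio_pos[of \<mu> n]
      by (intro mult_mono) (auto simp: h_def)
    also have "\<dots> = exp (1/2 * (1 - (real (Suc n) - \<mu>) * h))"
      by (simp add: exp_add[symmetric] algebra_simps flip: add_divide_distrib)
    finally show ?thesis .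
  qed
  then show ?case using 1 by (simp add: h_def)
qed

text \<open>Downward from the mode the ratios are (n+1) / \<mu>, at most 1 - h once n+1 is one
  standard deviation below the mean. The ratio involves n+1 and not n, which is why the constant is
  2 here and 1 in the upper tail.\<close>

lemma pois_ratio_lower_tail:
  assumes \<mu>: "\<mu> \<ge> 1" and n: "n \<le> nat \<lfloor>\<mu>\<rfloor>"
  shows "pois_ratio \<mu> n \<le> 1 \<and> pois_ratio \<mu> n \<le> exp (1/2 * (2 - (\<mu> - real n) / sqrt \<mu>))"
  using n
proof (induction n rule: inc_induct)
  case base
  have "\<mu> - real (nat \<lfloor>\<mu>\<rfloor>) \<le> 1 * sqrt \<mu>" using \<mu> real_sqrt_ge_one[OF \<mu>] by linarith
  then have "(\<mu> - real (nat \<lfloor>\<mu>\<rfloor>)) / sqrt \<mu> \<le> 1"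
    using \<mu> by (subst pos_divide_le_eq) auto
  then have "0 \<le> 1/2 * (2 - (\<mu> - real (nat \<lfloor>\<mu>\<rfloor>)) / sqrt \<mu>)"
    by (intro half_diff_nonneg) linarith
  then have "1 \<le> exp (1/2 * (2 - (\<mu> - real (nat \<lfloor>\<mu>\<rfloor>)) / sqrt \<mu>))"
    by (simp only: one_le_exp_iff)
  moreover have "pois_ratio \<mu> (nat \<lfloor>\<mu>\<rfloor>) = 1" using \<mu> by (intro pois_ratio_floor) auto
  ultimately show ?case by (simp only: order_refl simp_thms)
next
  case (step n)
  define h where "h = 1 / sqrt \<mu>"
  have h: "0 < h" "h \<le> 1" "\<mu> * h = sqrt \<mu>" "sqrt \<mu> * h = 1"
    using \<mu> by (auto simp: h_def real_div_sqrt)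
  have n1: "real (Suc n) \<le> \<mu>" using step \<mu> by linarith
  have eq: "pois_ratio \<mu> n = pois_ratio \<mu> (Suc n) * (real (Suc n) / \<mu>)"
    unfolding pois_ratio_Suc using \<mu> by simp
  have le1: "real (Suc n) / \<mu> \<le> 1" using n1 \<mu> by (simp add: divide_simps)
  have 1: "pois_ratio \<mu> n \<le> 1"
    unfolding eq
    using mult_mono[OF conjunct1[OF step(3)] le1] \<mu> by simp
  have "pois_ratio \<mu> n \<le> exp (1/2 * (2 - (\<mu> - real n) * h))"
  proof (cases "real (Suc n) \<le> \<mu> - sqrt \<mu>")
    case False
    \<comment> \<open>The extra 1 is the step from n+1 back to n; the product is 1 + h, at most
      2.\<close>
    then have "(\<mu> - real n) * h \<le> (sqrt \<mu> + 1) * h"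
      using h by (intro mult_right_mono) auto
    also have "\<dots> \<le> 2" using h by (simp add: algebra_simps)
    finally have X: "0 \<le> 1/2 * (2 - (\<mu> - real n) * h)" by simp
    show ?thesis using 1 X[folded one_le_exp_iff] by linarith
  next
    case True
    have "real (Suc n) / \<mu> \<le> (\<mu> - sqrt \<mu>) / \<mu>"
      using True \<mu> by (intro divide_right_mono) auto
    also have "\<dots> = 1 - h" unfolding h(3)[symmetric] using \<mu> by (simp add: diff_divide_distrib)
    also have "\<dots> \<le> exp (- h)" using exp_ge_add_one_self[of "-h"] by simp
    also have "\<dots> \<le> exp (- h / 2)" using h by simp
    finally have "real (Suc n) / \<mu> \<le> exp (- h / 2)" .
    then have "pois_ratio \<mu> n \<le> exp (1/2 * (2 - (\<mu> - real (Suc n)) * h)) * exp (- h / 2)"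
      unfolding eq using step(3) \<mu> pois_ratio_pos[of \<mu> n]
      by (intro mult_mono) (auto simp: h_def)
    also have "\<dots> = exp (1/2 * (2 - (\<mu> - real n) * h))"
      by (simp add: exp_add[symmetric] algebra_simps flip: add_divide_distrib)
    finally show ?thesis .
  qed
  then show ?case using 1 by (simp add: h_def)
qed

lemma pois_ratio_bound:
  assumes "\<mu> \<ge> 1"
  shows "pois_ratio \<mu> n \<le> exp 2 * exp (- (\<bar>real n - \<mu>\<bar> / sqrt \<mu>) / 2)"
proof -
  define h where "h = 1 / sqrt \<mu>"
  have h: "0 < h" "h \<le> 1" using assms by (auto simp: h_def)
  have "pois_ratio \<mu> n \<le> exp (2 - \<bar>real n - \<mu>\<bar> * h / 2)"
  proof (cases "nat \<lfloor>\<mu>\<rfloor> \<le> n")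
    case True
    \<comment> \<open>At the mode itself n may lie below \<mu>, but by less than 1.\<close>
    have "\<bar>real n - \<mu>\<bar> \<le> (real n - \<mu>) + 2" using True assms by linarith
    then have "\<bar>real n - \<mu>\<bar> * h \<le> ((real n - \<mu>) + 2) * h"
      using h by (intro mult_right_mono) auto
    then have "1/2 * (1 - (real n - \<mu>) * h) \<le> 2 - \<bar>real n - \<mu>\<bar> * h / 2"
      unfolding distrib_right using h by simp
    moreover have "pois_ratio \<mu> n \<le> exp (1/2 * (1 - (real n - \<mu>) * h))"
      using pois_ratio_upper_tail[OF assms True] by (simp add: h_def)
    ultimately show ?thesis by (meson exp_le_cancel_iff order_trans)
  next
    case False
    then have n: "n \<le> nat \<lfloor>\<mu>\<rfloor>" by simp
    then have "\<bar>real n - \<mu>\<bar> = \<mu> - real n" using assms by linarith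
    then have "1/2 * (2 - (\<mu> - real n) * h) \<le> 2 - \<bar>real n - \<mu>\<bar> * h / 2" by simp
    moreover have "pois_ratio \<mu> n \<le> exp (1/2 * (2 - (\<mu> - real n) * h))"
      using pois_ratio_lower_tail[OF assms n] by (simp add: h_def)
    ultimately show ?thesis by (meson exp_le_cancel_iff order_trans)
  qed
  then show ?thesis by (simp add: h_def exp_diff exp_minus field_simps)
qed

text \<open>The left-hand difference of logarithms telescopes into the sum of ln (j / \<mu>) for p <
  j \<le> q. With u = (j - \<mu>) / \<mu>, replacing ln (1 + u) by u costs at most 2 u^2, valid
  since M \<le> \<mu> / 2 forces |u| \<le> 1/2, and the u sum exactly to the arithmetic-series term.
  This elementary estimate does the work of Stirling's formula.\<close>

lemma ln_fact_quotient_aux: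
  assumes "0 < \<mu>" "M \<le> \<mu> / 2" "p \<le> q" "\<bar>real p - \<mu>\<bar> \<le> M" "\<bar>real q - \<mu>\<bar> \<le> M"
  shows "\<bar>(ln (fact q) - ln (fact p) - (real q - real p) * ln \<mu>)
     - (real q - real p) * ((real p + real q + 1) / 2 - \<mu>) / \<mu>\<bar> \<le> (real q - real p) * (2 * (M / \<mu>)\<^sup>2)"
  using assms(3,5)
proof (induction q rule: dec_induct)
  case base
  then show ?case by simp
next
  case (step q)
  define u where "u = (real (Suc q) - \<mu>) / \<mu>"
  have M: "\<bar>real q - \<mu>\<bar> \<le> M" "\<bar>real (Suc q) - \<mu>\<bar> \<le> M" using step assms by auto
  have "\<bar>u\<bar> \<le> M / \<mu>" unfolding u_def using M(2) assms(1) by (simp add: divide_right_mono)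
  moreover have "M / \<mu> \<le> 1/2" using assms by (simp add: field_simps)
  ultimately have ln_u: "\<bar>ln (1 + u) - u\<bar> \<le> 2 * (M / \<mu>)\<^sup>2"
    using abs_ln_one_plus_x_minus_x_bound[of u] power_mono[of "\<bar>u\<bar>" "M / \<mu>" 2]
    unfolding power2_abs by linarith
  have "1 + u = real (Suc q) / \<mu>" using assms(1) by (simp add: u_def field_simps)
  with assms(1) have "ln (1 + u) = ln (real (Suc q)) - ln \<mu>"
    by (simp add: ln_div del: of_nat_Suc)
  note ln_u this
  moreover have "ln (fact (Suc q)) = ln (real (Suc q)) + ln (fact q :: real)"
    unfolding fact_Suc by (subst ln_mult) auto
  moreover have "(real (Suc q) - real p) * ((real p + real (Suc q) + 1) / 2 - \<mu>) / \<mu> =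
     (real q - real p) * ((real p + real q + 1) / 2 - \<mu>) / \<mu> + u"
    using assms(1) by (simp add: u_def field_simps)
  moreover have "(real (Suc q) - real p) * ln \<mu> = (real q - real p) * ln \<mu> + ln \<mu>"
    "(real (Suc q) - real p) * (2 * (M / \<mu>)\<^sup>2) = (real q - real p) * (2 * (M / \<mu>)\<^sup>2) + 2 * (M / \<mu>)\<^sup>2"
    by (simp_all add: algebra_simps)
  ultimately show ?case using step(3)[OF M(1)] by linarith
qed

text \<open>Both expressions inside the absolute value change sign when p and q are exchanged, which
  removes the order assumption.\<close>

lemma ln_fact_quotient:
  assumes "0 < \<mu>" "M \<le> \<mu> / 2" "\<bar>real p - \<mu>\<bar> \<le> M" "\<bar>real q - \<mu>\<bar> \<le> M"
  shows "\<bar>(ln (fact q) - ln (fact p) - (real q - real p) * ln \<mu>)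
     - (real q - real p) * ((real p + real q + 1) / 2 - \<mu>) / \<mu>\<bar> \<le> \<bar>real q - real p\<bar> * (2 * (M / \<mu>)\<^sup>2)"
proof (cases "p \<le> q")
  case True
  then show ?thesis using ln_fact_quotient_aux[OF assms(1,2) True assms(3,4)] by simp
next
  case False
  then have "q \<le> p" by simp
  have G: "(real p - real q) * ((real q + real p + 1) / 2 - \<mu>) / \<mu>
      = - ((real q - real p) * ((real p + real q + 1) / 2 - \<mu>) / \<mu>)"
    unfolding minus_divide_left by (rule arg_cong[of _ _ "\<lambda>x. x / \<mu>"]) (simp add: field_simps)
  have 1: "\<bar>real q - real p\<bar> = real p - real q" using \<open>q \<le> p\<close> by simp
  have 2: "(real p - real q) * ln \<mu> = - ((real q - real p) * ln \<mu>)" by (simp add: algebra_simps)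
  show ?thesis
    using ln_fact_quotient_aux[OF assms(1,2) \<open>q \<le> p\<close> assms(4,3)] unfolding G 1 2 by linarith
qed

lemma ln_pois_ratio:
  assumes "\<mu> > 0"
  shows "ln (pois_ratio \<mu> n) =
    - (ln (fact n) - ln (fact (nat \<lfloor>\<mu>\<rfloor>)) - (real n - real (nat \<lfloor>\<mu>\<rfloor>)) * ln \<mu>)"
  unfolding pois_ratio_def using assms
  by (simp add: ln_div ln_mult ln_realpow algebra_simps)

text \<open>The logarithm of the ratio is minus a factorial quotient between the mode p and n. Its
  main term \<open>G\<close> is quadratic in the standardized deviations of n and p; the former
  tends to t, the latter to 0 because the mode is within 1 of the mean.\<close>

lemma pois_ratio_local_limit:
  assumes \<mu>: "filterlim \<mu> at_top sequentially"
    and t: "(\<lambda>k. (real (n k) - \<mu> k) / sqrt (\<mu> k)) \<longlonglongrightarrow> t"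
  shows "(\<lambda>k. pois_ratio (\<mu> k) (n k)) \<longlonglongrightarrow> exp (- t\<^sup>2 / 2)"
proof -
  define p where "p k = nat \<lfloor>\<mu> k\<rfloor>" for k
  \<comment> \<open>The summand 1 lets \<open>M\<close> dominate the distance of the mode from the
    mean as well.\<close>
  define M where "M k = \<bar>real (n k) - \<mu> k\<bar> + 1" for k
  define h where "h k = 1 / sqrt (\<mu> k)" for k
  define G where "G k = (real (n k) - real (p k)) * ((real (p k) + real (n k) + 1) / 2 - \<mu> k) / \<mu> k" for k
  have ev: "\<forall>\<^sub>F k in sequentially. \<mu> k \<ge> 1" using \<mu> by (auto simp: filterlim_at_top)
  have h0: "h \<longlonglongrightarrow> 0"
    unfolding h_def using filterlim_compose[OF sqrt_at_top \<mu>]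
    by (simp add: divide_inverse tendsto_inverse_0_at_top)
  have tn: "(\<lambda>k. (real (n k) - \<mu> k) * h k) \<longlonglongrightarrow> t" using t by (simp add: h_def)
  have tp: "(\<lambda>k. (real (p k) - \<mu> k) * h k) \<longlonglongrightarrow> 0"
  proof (rule Lim_null_comparison[OF _ h0])
    show "\<forall>\<^sub>F k in sequentially. norm ((real (p k) - \<mu> k) * h k) \<le> h k"
      using ev
    proof eventually_elim
      case (elim k)
      then have "\<bar>real (p k) - \<mu> k\<bar> \<le> 1" unfolding p_def by linarith
      moreover have "h k \<ge> 0" using elim by (simp add: h_def)
      ultimately show ?case using mult_right_mono[of "\<bar>real (p k) - \<mu> k\<bar>" 1 "h k"] by (simp add: abs_mult)
    qed
  qed
  have tM: "(\<lambda>k. M k * h k) \<longlonglongrightarrow> \<bar>t\<bar>"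
  proof -
    have "(\<lambda>k. \<bar>(real (n k) - \<mu> k) * h k\<bar> + h k) \<longlonglongrightarrow> \<bar>t\<bar> + 0"
      by (intro tendsto_intros tn h0)
    moreover have "\<forall>\<^sub>F k in sequentially. \<bar>(real (n k) - \<mu> k) * h k\<bar> + h k = M k * h k"
      using ev
    proof eventually_elim
      case (elim k)
      then have "h k \<ge> 0" by (simp add: h_def)
      then show ?case by (simp only: M_def abs_mult abs_of_nonneg distrib_right mult_1)
    qed
    ultimately show ?thesis by (simp add: tendsto_cong)
  qed
  have hh: "\<forall>\<^sub>F k in sequentially. h k * h k = 1 / \<mu> k"
    using ev by eventually_elim (simp add: h_def)
  have MM: "\<forall>\<^sub>F k in sequentially. M k \<le> \<mu> k / 2"
  proof -
    have "(\<lambda>k. (M k * h k) * h k) \<longlonglongrightarrow> \<bar>t\<bar> * 0" by (intro tendsto_intros tM h0)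
    then have "\<forall>\<^sub>F k in sequentially. (M k * h k) * h k < 1/2"
      by (rule order_tendstoD(2)) simp
    then show ?thesis using hh ev
      by eventually_elim (simp add: mult.assoc field_simps)
  qed
  have lim_G: "G \<longlonglongrightarrow> t\<^sup>2 / 2"
  proof -
    \<comment> \<open>Distributing one factor \<open>h\<close> to each bracket of \<open>G\<close>
      writes it in standardized deviations; the half-integer correction in the arithmetic series
      becomes h / 2 and disappears.\<close>
    have "(\<lambda>k. ((real (n k) - \<mu> k) * h k - (real (p k) - \<mu> k) * h k) *
        (((real (n k) - \<mu> k) * h k + (real (p k) - \<mu> k) * h k + h k) / 2)) \<longlonglongrightarrow> (t - 0) * ((t + 0 + 0) / 2)"
      by (intro tendsto_intros tn tp h0) auto
    moreover have "\<forall>\<^sub>F k in sequentially. ((real (n k) - \<mu> k) * h k - (real (p k) - \<mu> k) * h k) *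
        (((real (n k) - \<mu> k) * h k + (real (p k) - \<mu> k) * h k + h k) / 2) = G k"
      using hh
    proof eventually_elim
      case (elim k)
      have "((real (n k) - \<mu> k) * h k - (real (p k) - \<mu> k) * h k) *
        (((real (n k) - \<mu> k) * h k + (real (p k) - \<mu> k) * h k + h k) / 2) =
        (real (n k) - real (p k)) * ((real (p k) + real (n k) + 1) / 2 - \<mu> k) * (h k * h k)"
        by (simp add: field_simps)
      then show ?case unfolding elim G_def by simp
    qed
    ultimately show ?thesis by (simp add: tendsto_cong power2_eq_square)
  qed
  have "(\<lambda>k. - ln (pois_ratio (\<mu> k) (n k)) - G k) \<longlonglongrightarrow> 0"
  proof (rule Lim_null_comparison)
    \<comment> \<open>The error is cubic in deviations over \<mu>^2, so after standardizing three
      factors one factor \<open>h\<close> is left over and tends to 0.\<close>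
    show "(\<lambda>k. \<bar>(real (n k) - \<mu> k) * h k - (real (p k) - \<mu> k) * h k\<bar> * (2 * (M k * h k)\<^sup>2) * h k) \<longlonglongrightarrow> 0"
      using tendsto_mult[OF tendsto_mult[OF tendsto_rabs[OF tendsto_diff[OF tn tp]] tendsto_mult[OF tendsto_const[of 2] tendsto_power[OF tM, of 2]]] h0] by simp
    show "\<forall>\<^sub>F k in sequentially. norm (- ln (pois_ratio (\<mu> k) (n k)) - G k)
      \<le> \<bar>(real (n k) - \<mu> k) * h k - (real (p k) - \<mu> k) * h k\<bar> * (2 * (M k * h k)\<^sup>2) * h k"
      using ev hh MM
    proof eventually_elim
      case (elim k)
      have "\<bar>real (p k) - \<mu> k\<bar> \<le> 1" unfolding p_def using elim by linarith
      then have "\<bar>real (p k) - \<mu> k\<bar> \<le> M k" by (simp add: M_def)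
      moreover have "\<bar>real (n k) - \<mu> k\<bar> \<le> M k" by (simp add: M_def)
      ultimately have "\<bar>- ln (pois_ratio (\<mu> k) (n k)) - G k\<bar> \<le> \<bar>real (n k) - real (p k)\<bar> * (2 * (M k / \<mu> k)\<^sup>2)"
        using ln_fact_quotient[of "\<mu> k" "M k" "p k" "n k"] elim
        by (simp add: ln_pois_ratio G_def p_def)
      also have "\<dots> = \<bar>real (n k) - real (p k)\<bar> * (2 * (M k * (h k * h k))\<^sup>2)" using elim by simp
      also have "\<dots> = \<bar>(real (n k) - real (p k)) * h k\<bar> * (2 * (M k * h k)\<^sup>2) * h k"
        using elim by (simp add: h_def abs_mult power2_eq_square)
      finally show ?case by (simp add: algebra_simps)
    qed
  qed
  then have "(\<lambda>k. - (- ln (pois_ratio (\<mu> k) (n k)) - G k) - G k) \<longlonglongrightarrow> - 0 - t\<^sup>2 / 2"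
    by (intro tendsto_intros lim_G)
  then have "(\<lambda>k. exp (ln (pois_ratio (\<mu> k) (n k)))) \<longlonglongrightarrow> exp (- t\<^sup>2 / 2)"
    by (intro tendsto_intros) simp
  moreover have "\<forall>\<^sub>F k in sequentially. exp (ln (pois_ratio (\<mu> k) (n k))) = pois_ratio (\<mu> k) (n k)"
    using ev by eventually_elim (simp add: pois_ratio_pos)
  ultimately show ?thesis by (simp add: tendsto_cong)
qed

section \<open>Lebesgue measure on a subspace\<close>

definition onb_list :: "'a::euclidean_space list \<Rightarrow> 'a set \<Rightarrow> bool" where
  "onb_list bs L \<longleftrightarrow> distinct bs \<and> pairwise orthogonal (set bs) \<and> (\<forall>b\<in>set bs. norm b = 1) \<and> span (set bs) = L"

definition list_comb :: "'a::euclidean_space list \<Rightarrow> (nat \<Rightarrow> real) \<Rightarrow> 'a" where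
  "list_comb bs t = (\<Sum>j<length bs. t j *\<^sub>R bs ! j)"

text \<open>The choice of a basis inside \<open>subspace_lebesgue\<close> is opened only through
  this lemma; later arguments work with whichever orthonormal basis the choice returns.\<close>

lemma subspace_lebesgue_onb:
  fixes L :: "'a::euclidean_space set"
  assumes "subspace L"
  obtains bs where "onb_list bs L"
    "subspace_lebesgue L = distr (Pi\<^sub>M {..<length bs} (\<lambda>_. lborel)) borel (list_comb bs)"
proof -
  define bs where "bs = (SOME bs. onb_list bs L)"
  obtain B where B: "B \<subseteq> L" "pairwise orthogonal B" "\<And>x. x \<in> B \<Longrightarrow> norm x = 1"
    "independent B" "span B = L"
    using orthonormal_basis_subspace[OF assms] by metis
  obtain xs where "set xs = B" "distinct xs"
    using finite_distinct_list independent_imp_finite[OF B(4)] by blast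
  then have "\<exists>bs. onb_list bs L" using B by (auto simp: onb_list_def)
  then have "onb_list bs L" unfolding bs_def by (rule someI_ex)
  moreover have "subspace_lebesgue L = distr (Pi\<^sub>M {..<length bs} (\<lambda>_. lborel)) borel (list_comb bs)"
    unfolding subspace_lebesgue_def bs_def onb_list_def list_comb_def[abs_def] Let_def by simp
  ultimately show ?thesis using that by blast
qed

lemma measurable_list_comb[measurable]:
  "list_comb bs \<in> borel_measurable (Pi\<^sub>M {..<length bs} (\<lambda>_. lborel))"
  unfolding list_comb_def[abs_def] by measurable

lemma onb_list_inner:
  assumes "onb_list bs L" "i < length bs" "j < length bs"
  shows "bs ! i \<bullet> bs ! j = (if i = j then 1 else 0)"
proof (cases "i = j")
  case True
  have "norm (bs ! j) = 1" using assms by (auto simp: onb_list_def)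
  then show ?thesis using True by (simp add: dot_square_norm)
next
  case False
  then have "bs ! i \<noteq> bs ! j" using assms by (auto simp: onb_list_def nth_eq_iff_index_eq)
  then show ?thesis using assms False
    by (auto simp: onb_list_def pairwise_def orthogonal_def)
qed

lemma list_comb_inner:
  assumes "onb_list bs L" "j < length bs"
  shows "list_comb bs t \<bullet> bs ! j = t j"
proof -
  have "list_comb bs t \<bullet> bs ! j = (\<Sum>i<length bs. t i * (if i = j then 1 else 0))"
    unfolding list_comb_def inner_sum_left using assms
    by (intro sum.cong) (auto simp: onb_list_inner)
  also have "\<dots> = t j" using assms by (simp add: if_distrib cong: if_cong)
  finally show ?thesis .
qed

lemma list_comb_mem:
  assumes "onb_list bs L"
  shows "list_comb bs t \<in> L"
proof -
  have "list_comb bs t \<in> span (set bs)"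
    unfolding list_comb_def by (intro span_sum span_scale span_base) auto
  then show ?thesis using assms by (simp add: onb_list_def)
qed

lemma list_comb_surj:
  assumes "onb_list bs L" "z \<in> L"
  obtains c where "list_comb bs c = z"
proof -
  have "z \<in> span (set bs)" "distinct bs" using assms by (auto simp: onb_list_def)
  then obtain u where "z = (\<Sum>v\<in>set bs. u v *\<^sub>R v)"
    by (auto simp: span_finite)
  then have "z = list_comb bs (\<lambda>j. u (bs ! j))"
    unfolding list_comb_def using \<open>distinct bs\<close>
    by (simp add: sum.reindex_bij_betw[OF bij_betw_nth[OF \<open>distinct bs\<close> refl refl], symmetric])
  then show ?thesis using that by blast
qed

text \<open>A product measure is determined by its boxes, and on a box the one-dimensional affine
  rule contributes one factor |s| per coordinate.\<close>

lemma PiM_lborel_affine: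
  fixes c :: "'i \<Rightarrow> real"
  assumes I: "finite I" and s: "s \<noteq> 0"
  defines "M \<equiv> Pi\<^sub>M I (\<lambda>_. lborel :: real measure)"
  shows "M = density (distr M M (\<lambda>t. \<lambda>i\<in>I. c i + s * t i)) (\<lambda>_. ennreal (\<bar>s\<bar> ^ card I))"
  unfolding M_def
proof (rule product_sigma_finite.PiM_eqI[symmetric])
  show "product_sigma_finite (\<lambda>_::'i. lborel :: real measure)"
    by (simp add: product_sigma_finite_def sigma_finite_lborel)
  show "finite I" by fact
  let ?M = "Pi\<^sub>M I (\<lambda>_. lborel :: real measure)"
  let ?T = "\<lambda>t. \<lambda>i\<in>I. c i + s * t i"
  show "sets (density (distr ?M ?M ?T) (\<lambda>_. ennreal (\<bar>s\<bar> ^ card I))) = sets ?M" by simp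
  have T[measurable]: "?T \<in> measurable ?M ?M" by measurable
  fix A :: "'i \<Rightarrow> real set" assume A: "\<And>i. i \<in> I \<Longrightarrow> A i \<in> sets lborel"
  have PA: "Pi\<^sub>E I A \<in> sets ?M" using A I by (intro sets_PiM_I_finite) auto
  have AB: "(\<lambda>x. c i + s * x) -` A i \<in> sets lborel" if "i \<in> I" for i
  proof -
    have "(\<lambda>x. c i + s * x) \<in> borel_measurable borel" by measurable
    from measurable_sets[OF this, of "A i"] A[OF that] show ?thesis by simp
  qed
  have pre: "?T -` Pi\<^sub>E I A \<inter> space ?M = Pi\<^sub>E I (\<lambda>i. (\<lambda>x. c i + s * x) -` A i)"
    by (auto simp: space_PiM PiE_iff extensional_def)
  have "emeasure (density (distr ?M ?M ?T) (\<lambda>_. ennreal (\<bar>s\<bar> ^ card I))) (Pi\<^sub>E I A)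
     = ennreal (\<bar>s\<bar> ^ card I) * emeasure ?M (Pi\<^sub>E I (\<lambda>i. (\<lambda>x. c i + s * x) -` A i))"
    using PA by (simp add: emeasure_density_const emeasure_distr pre)
  also have "emeasure ?M (Pi\<^sub>E I (\<lambda>i. (\<lambda>x. c i + s * x) -` A i)) =
     (\<Prod>i\<in>I. emeasure lborel ((\<lambda>x. c i + s * x) -` A i))"
    using AB I by (intro product_sigma_finite.emeasure_PiM) (auto simp: product_sigma_finite_def sigma_finite_lborel)
  also have "ennreal (\<bar>s\<bar> ^ card I) * \<dots> =
     (\<Prod>i\<in>I. ennreal \<bar>s\<bar> * emeasure lborel ((\<lambda>x. c i + s * x) -` A i))"
    by (simp add: prod.distrib ennreal_power)
  also have "\<dots> = (\<Prod>i\<in>I. emeasure lborel (A i))"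
  proof (rule prod.cong[OF refl])
    fix i assume i: "i \<in> I"
    have "emeasure lborel (A i) =
      emeasure (density (distr lborel borel (\<lambda>x. c i + s * x)) (\<lambda>_. ennreal \<bar>s\<bar>)) (A i)"
      using lborel_real_affine[OF s, of "c i"] by simp
    also have "\<dots> = ennreal \<bar>s\<bar> * emeasure lborel ((\<lambda>x. c i + s * x) -` A i)"
      using A[OF i] by (simp add: emeasure_density_const emeasure_distr)
    finally show "ennreal \<bar>s\<bar> * emeasure lborel ((\<lambda>x. c i + s * x) -` A i) = emeasure lborel (A i)" ..
  qed
  finally show "emeasure (density (distr ?M ?M ?T) (\<lambda>_. ennreal (\<bar>s\<bar> ^ card I))) (Pi\<^sub>E I A) =
     (\<Prod>i\<in>I. emeasure lborel (A i))" .
qed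

lemma sets_subspace_lebesgue[simp, measurable_cong]: "sets (subspace_lebesgue L) = sets borel"
  by (simp add: subspace_lebesgue_def Let_def)

lemma space_subspace_lebesgue[simp]: "space (subspace_lebesgue L) = UNIV"
  by (simp add: subspace_lebesgue_def Let_def)

lemma onb_list_length:
  assumes "onb_list bs L"
  shows "length bs = dim L"
proof -
  have "independent (set bs)"
    using assms by (intro pairwise_orthogonal_independent) (auto simp: onb_list_def)
  then have "dim (span (set bs)) = card (set bs)" by (rule dim_span_eq_card_independent)
  then show ?thesis using assms by (metis onb_list_def distinct_card dim_span)
qed

text \<open>In coordinates the map is again affine with scale s, its offset being the coefficients
  of z; hence z has to lie in \<open>L\<close>. The case of large s gives the volume of small
  lattice cells, the case s = -1 the symmetry of the Gaussian.\<close>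

lemma subspace_lebesgue_affine:
  fixes L :: "'a::euclidean_space set"
  assumes L: "subspace L" and z: "z \<in> L" and s: "s \<noteq> 0"
  shows "subspace_lebesgue L =
     density (distr (subspace_lebesgue L) borel (\<lambda>x. z + s *\<^sub>R x)) (\<lambda>_. ennreal (\<bar>s\<bar> ^ dim L))"
proof -
  obtain bs where bs: "onb_list bs L"
    "subspace_lebesgue L = distr (Pi\<^sub>M {..<length bs} (\<lambda>_. lborel)) borel (list_comb bs)"
    using subspace_lebesgue_onb[OF L] .
  let ?M = "Pi\<^sub>M {..<length bs} (\<lambda>_. lborel :: real measure)"
    obtain c where c: "list_comb bs c = z" using list_comb_surj[OF bs(1) z] .
    let ?T = "\<lambda>t. \<lambda>i\<in>{..<length bs}. c i + s * t i"
    have T[measurable]: "?T \<in> measurable ?M ?M" by measurable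
    have comp: "list_comb bs (?T t) = z + s *\<^sub>R list_comb bs t" for t
      unfolding c[symmetric] by (simp add: list_comb_def scaleR_sum_right sum.distrib[symmetric] algebra_simps)
    show ?thesis
    proof (rule measure_eqI)
      fix A :: "'a set" assume "A \<in> sets (subspace_lebesgue L)"
      then have A[measurable]: "A \<in> sets borel" by simp
      have zA: "(\<lambda>x. z + s *\<^sub>R x) -` A \<in> sets borel"
        using measurable_sets[of "\<lambda>x. z + s *\<^sub>R x" borel borel A] by simp
      have lA: "list_comb bs -` B \<inter> space ?M \<in> sets ?M" if "B \<in> sets borel" for B :: "'a set"
        using measurable_sets[OF measurable_list_comb that] .
      have "emeasure (subspace_lebesgue L) A = emeasure ?M (list_comb bs -` A \<inter> space ?M)"
        unfolding bs(2) by (simp add: emeasure_distr)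
      also have "\<dots> = ennreal (\<bar>s\<bar> ^ length bs) * emeasure ?M (?T -` (list_comb bs -` A \<inter> space ?M) \<inter> space ?M)"
        by (subst PiM_lborel_affine[OF finite_lessThan s, of _ c])
           (use lA[OF A] in \<open>simp add: emeasure_density_const emeasure_distr\<close>)
      also have "?T -` (list_comb bs -` A \<inter> space ?M) \<inter> space ?M =
         list_comb bs -` ((\<lambda>x. z + s *\<^sub>R x) -` A) \<inter> space ?M"
        using measurable_space[OF T] by (auto simp: comp)
      also have "emeasure ?M \<dots> = emeasure (subspace_lebesgue L) ((\<lambda>x. z + s *\<^sub>R x) -` A)"
        unfolding bs(2) using zA by (simp add: emeasure_distr)
      finally show "emeasure (subspace_lebesgue L) A =
        emeasure (density (distr (subspace_lebesgue L) borel (\<lambda>x. z + s *\<^sub>R x)) (\<lambda>_. ennreal (\<bar>s\<bar> ^ dim L))) A"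
        by (simp add: emeasure_density_const emeasure_distr onb_list_length[OF bs(1)])
    qed simp
qed

section \<open>Concentration on the subspace, nontriviality and integrability\<close>

lemma AE_subspace_lebesgue:
  fixes L :: "'a::euclidean_space set"
  assumes L: "subspace L"
  shows "AE x in subspace_lebesgue L. x \<in> L"
proof -
  obtain bs where bs: "onb_list bs L"
    "subspace_lebesgue L = distr (Pi\<^sub>M {..<length bs} (\<lambda>_. lborel)) borel (list_comb bs)"
    using subspace_lebesgue_onb[OF L] .
  have "L \<in> sets borel" using closed_subspace[OF L] by simp
  then show ?thesis unfolding bs(2)
    by (subst AE_distr_iff) (use list_comb_mem[OF bs(1)] in auto)
qed

text \<open>The total mass is a product of infinite lengths, or the empty product 1 when
  \<open>L\<close> is the zero space and the measure is a point mass; neither is 0.\<close>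

lemma subspace_lebesgue_nonzero:
  fixes L :: "'a::euclidean_space set"
  assumes L: "subspace L"
  shows "emeasure (subspace_lebesgue L) UNIV \<noteq> 0"
proof -
  obtain bs where bs: "onb_list bs L"
    "subspace_lebesgue L = distr (Pi\<^sub>M {..<length bs} (\<lambda>_. lborel)) borel (list_comb bs)"
    using subspace_lebesgue_onb[OF L] .
  have "emeasure (subspace_lebesgue L) UNIV = emeasure (Pi\<^sub>M {..<length bs} (\<lambda>_. lborel :: real measure)) (Pi\<^sub>E {..<length bs} (\<lambda>_. UNIV))"
    unfolding bs(2) by (simp add: emeasure_distr space_PiM)
  also have "\<dots> = (\<Prod>i<length bs. emeasure lborel (UNIV :: real set))"
    by (intro product_sigma_finite.emeasure_PiM) (auto simp: product_sigma_finite_def sigma_finite_lborel)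
  also have "\<dots> \<noteq> 0" by simp
  finally show ?thesis .
qed

lemma nn_integral_exp_abs_finite:
  assumes "(c::real) > 0"
  shows "(\<integral>\<^sup>+t. ennreal (exp (- c * \<bar>t\<bar>)) \<partial>lborel) < \<infinity>"
proof -
  have h: "(\<integral>\<^sup>+t. ennreal (exp (- t)) * indicator {0..} t \<partial>lborel) = 1"
    using nn_intergal_power_times_exp_Ici[of 0] by simp
  have h2: "(\<integral>\<^sup>+t. ennreal (exp (- (c * t))) * indicator {0..} t \<partial>lborel) < \<infinity>"
  proof -
    have "1 = ennreal c * (\<integral>\<^sup>+t. ennreal (exp (- (c * t))) * indicator {0..} (c * t) \<partial>lborel)"
      using nn_integral_real_affine[of "\<lambda>t. ennreal (exp (- t)) * indicator {0..} t" c 0] assms h by simp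
    also have "(\<lambda>t. indicator {0..} (c * t) :: ennreal) = indicator {0..}"
      using assms by (auto simp: fun_eq_iff indicator_def zero_le_mult_iff)
    finally have "ennreal c * (\<integral>\<^sup>+t. ennreal (exp (- (c * t))) * indicator {0..} t \<partial>lborel) < \<infinity>"
      by (metis ennreal_one_less_top infinity_ennreal_def)
    then show ?thesis using assms by (auto simp: ennreal_mult_less_top)
  qed
  have h3: "(\<integral>\<^sup>+t. ennreal (exp (c * t)) * indicator {..0} t \<partial>lborel) < \<infinity>"
  proof -
    have "(\<integral>\<^sup>+t. ennreal (exp (c * t)) * indicator {..0} t \<partial>lborel) =
      (\<integral>\<^sup>+t. ennreal (exp (- (c * t))) * indicator {..0} (- t) \<partial>lborel)"
      using nn_integral_real_affine[of "\<lambda>t. ennreal (exp (c * t)) * indicator {..0} t" "-1" 0] by simp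
    also have "(\<lambda>t. indicator {..0} (- t) :: ennreal) = indicator {0::real..}"
      by (auto simp: fun_eq_iff indicator_def)
    finally show ?thesis using h2 by simp
  qed
  have "(\<integral>\<^sup>+t. ennreal (exp (- c * \<bar>t\<bar>)) \<partial>lborel) \<le>
    (\<integral>\<^sup>+t. ennreal (exp (- (c * t))) * indicator {0..} t + ennreal (exp (c * t)) * indicator {..0} t \<partial>lborel)"
    by (intro nn_integral_mono) (auto simp: indicator_def)
  also have "\<dots> < \<infinity>" using h2 h3 by (subst nn_integral_add) auto
  finally show ?thesis .
qed

text \<open>By Cauchy-Schwarz each coordinate is bounded by the norm, so the integrand lies below a
  product of one-dimensional exponentials, whose integral factors.\<close>

lemma integrable_exp_norm_subspace:
  fixes L :: "'a::euclidean_space set"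
  assumes L: "subspace L" and c: "c > 0"
  shows "integrable (subspace_lebesgue L) (\<lambda>x. exp (- c * norm x))"
proof -
  obtain bs where bs: "onb_list bs L"
    "subspace_lebesgue L = distr (Pi\<^sub>M {..<length bs} (\<lambda>_. lborel)) borel (list_comb bs)"
    using subspace_lebesgue_onb[OF L] .
  \<comment> \<open>The added 1 keeps the quotient meaningful in dimension 0.\<close>
  define d where "d = c / real (length bs + 1)"
  have d: "d > 0" "d * real (length bs) \<le> c" using c by (auto simp: d_def field_simps)
  have le: "exp (- c * norm (list_comb bs t)) \<le> (\<Prod>j<length bs. exp (- d * \<bar>t j\<bar>))" for t
  proof -
    have "\<bar>t j\<bar> \<le> norm (list_comb bs t)" if "j < length bs" for j
    proof -
      have "norm (bs ! j) = 1" using bs(1) that by (auto simp: onb_list_def)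
      then show ?thesis
        using Cauchy_Schwarz_ineq2[of "list_comb bs t" "bs ! j"] list_comb_inner[OF bs(1) that, of t] by simp
    qed
    then have "(\<Sum>j<length bs. \<bar>t j\<bar>) \<le> (\<Sum>j<length bs. norm (list_comb bs t))"
      by (intro sum_mono) auto
    then have "d * (\<Sum>j<length bs. \<bar>t j\<bar>) \<le> d * (real (length bs) * norm (list_comb bs t))"
      using d by (intro mult_left_mono) auto
    also have "\<dots> \<le> c * norm (list_comb bs t)"
      using mult_right_mono[OF d(2), of "norm (list_comb bs t)"] by simp
    finally show ?thesis by (simp add: exp_sum[symmetric] sum_distrib_left sum_negf)
  qed
  show ?thesis
  proof (rule integrableI_bounded)
    have "(\<integral>\<^sup>+x. ennreal (norm (exp (- c * norm x))) \<partial>subspace_lebesgue L) =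
      (\<integral>\<^sup>+t. ennreal (exp (- c * norm (list_comb bs t))) \<partial>Pi\<^sub>M {..<length bs} (\<lambda>_. lborel))"
      unfolding bs(2) by (subst nn_integral_distr) auto
    also have "\<dots> \<le> (\<integral>\<^sup>+t. (\<Prod>j<length bs. ennreal (exp (- d * \<bar>t j\<bar>))) \<partial>Pi\<^sub>M {..<length bs} (\<lambda>_. lborel))"
      by (intro nn_integral_mono) (subst prod_ennreal, simp, rule ennreal_leI[OF le])
    also have "\<dots> = (\<Prod>j<length bs. (\<integral>\<^sup>+t. ennreal (exp (- d * \<bar>t\<bar>)) \<partial>lborel))"
      by (rule product_sigma_finite.product_nn_integral_prod)
         (auto simp: product_sigma_finite_def sigma_finite_lborel)
    also have "\<dots> < \<infinity>"
      using nn_integral_exp_abs_finite[OF d(1)] by (simp add: power_less_top_ennreal)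
    finally show "(\<integral>\<^sup>+x. ennreal (norm (exp (- c * norm x))) \<partial>subspace_lebesgue L) < \<infinity>" .
  qed simp
qed

section \<open>Lattices of integer points\<close>

lemma finite_integer_points:
  fixes S :: "(real^'n) set"
  assumes "bounded S"
  shows "finite {x \<in> S. \<forall>j. x $ j \<in> \<int>}"
proof -
  obtain D where D: "\<And>x. x \<in> S \<Longrightarrow> norm x \<le> D" using assms by (auto simp: bounded_iff)
  define N where "N = \<lceil>D\<rceil>"
  have "{x \<in> S. \<forall>j. x $ j \<in> \<int>} \<subseteq> vec_lambda ` Pi\<^sub>E UNIV (\<lambda>_. real_of_int ` {-N..N})"
  proof
    fix x assume x: "x \<in> {x \<in> S. \<forall>j. x $ j \<in> \<int>}"
    have "x $ j \<in> real_of_int ` {-N..N}" for j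
    proof -
      obtain i where i: "x $ j = of_int i" using x by (auto elim: Ints_cases)
      have "\<bar>x $ j\<bar> \<le> D" using component_le_norm_cart[of x j] D[of x] x by auto
      then have "i \<in> {-N..N}" unfolding i N_def by (auto; linarith)
      then show ?thesis unfolding i by blast
    qed
    then have "(\<lambda>j. x $ j) \<in> Pi\<^sub>E UNIV (\<lambda>_. real_of_int ` {-N..N})" by auto
    then show "x \<in> vec_lambda ` Pi\<^sub>E UNIV (\<lambda>_. real_of_int ` {-N..N})"
      by (metis imageI vec_nth_inverse)
  qed
  then show ?thesis by (rule finite_subset) (intro finite_imageI finite_PiE, auto)
qed

text \<open>Gram-Schmidt without normalization uses only quotients of inner products and so stays
  rational. If \<open>a\<close> depends on the earlier vectors then \<open>a'\<close> is 0; this is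
  harmless, since only orthogonality and the span matter.\<close>

lemma rational_orthogonal_basis:
  fixes S :: "(real^'n) set"
  assumes "finite S" "\<And>x j. x \<in> S \<Longrightarrow> x $ j \<in> \<rat>"
  shows "\<exists>T. finite T \<and> pairwise orthogonal T \<and> span T = span S \<and> (\<forall>x\<in>T. \<forall>j. x $ j \<in> \<rat>)"
  using assms
proof (induction S rule: finite_induct)
  case empty
  show ?case by (rule exI[of _ "{}"]) auto
next
  case (insert a S)
  then obtain T where T: "finite T" "pairwise orthogonal T" "span T = span S" "\<forall>x\<in>T. \<forall>j. x $ j \<in> \<rat>"
    by auto
  define a' where "a' = a - (\<Sum>b\<in>T. (b \<bullet> a / (b \<bullet> b)) *\<^sub>R b)"
  have orth: "orthogonal x a'" if "x \<in> T" for x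
    unfolding a'_def by (rule Gram_Schmidt_step[OF T(2)]) (simp add: that span_base)
  have "pairwise orthogonal (insert a' T)"
    using orth T(2) by (auto simp: pairwise_insert orthogonal_commute)
  moreover have "span (insert a' T) = span (insert a S)"
  proof -
    have "(\<Sum>b\<in>T. (b \<bullet> a / (b \<bullet> b)) *\<^sub>R b) \<in> span T"
      by (intro span_sum span_scale span_base)
    then have "- (\<Sum>b\<in>T. (b \<bullet> a / (b \<bullet> b)) *\<^sub>R b) \<in> span T" by (rule span_neg)
    also have "- (\<Sum>b\<in>T. (b \<bullet> a / (b \<bullet> b)) *\<^sub>R b) = a' - a" by (simp add: a'_def)
    finally have "a' - a \<in> span T" .
    then have "span (insert a' T) = span (insert a T)"
      by (rule eq_span_insert_eq)
    then show ?thesis using T(3) by (simp only: span_insert)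
  qed
  moreover have "a' $ j \<in> \<rat>" for j
  proof -
    have "x \<bullet> y \<in> \<rat>" if "\<forall>j. x $ j \<in> \<rat>" "\<forall>j. y $ j \<in> \<rat>" for x y :: "real^'n"
      unfolding inner_vec_def using that by (auto intro!: Rats_sum)
    then show ?thesis unfolding a'_def using T(4) insert.prems
      by (auto intro!: Rats_diff Rats_sum Rats_mult Rats_divide)
  qed
  ultimately show ?case using T by (intro exI[of _ "insert a' T"]) auto
qed

lemma rational_multiple_integer:
  fixes x :: "real^'n"
  assumes "\<And>j. x $ j \<in> \<rat>"
  shows "\<exists>N::nat. N > 0 \<and> (\<forall>j. (real N *\<^sub>R x) $ j \<in> \<int>)"
proof -
  have "\<exists>q::nat. q > 0 \<and> real q * x $ j \<in> \<int>" for j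
  proof -
    obtain a b where ab: "b > 0" "x $ j = of_int a / of_int b"
      using Rats_cases'[OF assms[of j]] by metis
    then have "real (nat b) * x $ j = of_int a" by simp
    then show ?thesis using ab by (intro exI[of _ "nat b"]) auto
  qed
  then obtain q where q: "\<And>j. q j > (0::nat)" "\<And>j. real (q j) * x $ j \<in> \<int>" by metis
  have "real (\<Prod>j\<in>UNIV. q j) * x $ i \<in> \<int>" for i
  proof -
    have "(\<Prod>j\<in>UNIV. q j) = q i * (\<Prod>j\<in>UNIV-{i}. q j)" by (simp add: prod.remove)
    then have "real (\<Prod>j\<in>UNIV. q j) * x $ i = real (\<Prod>j\<in>UNIV-{i}. q j) * (real (q i) * x $ i)" by simp
    also have "\<dots> \<in> \<int>" by (rule Ints_mult[OF Ints_of_nat q(2)])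
    finally show ?thesis .
  qed
  then show ?thesis using q(1) by (intro exI[of _ "\<Prod>j\<in>UNIV. q j"]) (auto intro: prod_pos)
qed

text \<open>The orthogonal projection onto \<open>L\<close> is rational, being computed from a
  rational orthogonal basis of the normal space. It therefore sends the coordinate vectors to
  rational vectors of \<open>L\<close>; these span \<open>L\<close>, and clearing denominators makes
  them integral.\<close>

lemma span_integer_points:
  fixes S :: "(real^'n) set"
  assumes S: "finite S" "\<And>x j. x \<in> S \<Longrightarrow> x $ j \<in> \<rat>"
  defines "L \<equiv> {x. \<forall>w\<in>S. w \<bullet> x = 0}"
  shows "span {x \<in> L. \<forall>j. x $ j \<in> \<int>} = L"
proof -
  obtain T where T: "finite T" "pairwise orthogonal T" "span T = span S" "\<forall>x\<in>T. \<forall>j. x $ j \<in> \<rat>"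
    using rational_orthogonal_basis[OF S] by blast
  have subL: "subspace L" by (auto simp: L_def subspace_def inner_simps)
  have perp: "w \<bullet> x = 0" if "x \<in> L" "w \<in> span S" for x w
  proof -
    have "subspace {w. w \<bullet> x = 0}" by (auto simp: subspace_def inner_simps)
    then have "span S \<subseteq> {w. w \<bullet> x = 0}" using that by (intro span_minimal) (auto simp: L_def)
    then show ?thesis using that by auto
  qed
  define p where "p a = a - (\<Sum>b\<in>T. (b \<bullet> a / (b \<bullet> b)) *\<^sub>R b)" for a :: "real^'n"
  have lin: "linear p" unfolding p_def
    by (intro linearI) (simp_all add: inner_simps add_divide_distrib scaleR_left_distrib
        sum.distrib scaleR_sum_right algebra_simps)
  have pL: "p a \<in> L" for a
  proof -
    have "orthogonal w (p a)" if "w \<in> S" for w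
      unfolding p_def using that T(3) by (intro Gram_Schmidt_step[OF T(2)]) (simp add: span_base)
    then show ?thesis by (auto simp: L_def orthogonal_def)
  qed
  have p_id: "p x = x" if "x \<in> L" for x
  proof -
    have "b \<bullet> x = 0" if "b \<in> T" for b using perp[OF \<open>x \<in> L\<close>, of b] that T(3) span_base by blast
    then show ?thesis by (simp add: p_def)
  qed
  let ?I = "{x \<in> L. \<forall>j. x $ j \<in> \<int>}"
  have pe: "p (axis i 1) \<in> span ?I" for i
  proof -
    have "p (axis i 1) $ j \<in> \<rat>" for j
    proof -
      have "x \<bullet> y \<in> \<rat>" if "\<forall>j. x $ j \<in> \<rat>" "\<forall>j. y $ j \<in> \<rat>" for x y :: "real^'n"
        unfolding inner_vec_def using that by (auto intro!: Rats_sum)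
      moreover have "axis i 1 $ j \<in> (\<rat> :: real set)" for j :: 'n by (auto simp: axis_def)
      ultimately show ?thesis unfolding p_def using T(4)
        by (auto intro!: Rats_diff Rats_sum Rats_mult Rats_divide)
    qed
    then obtain N :: nat where N: "N > 0" "\<forall>j. (real N *\<^sub>R p (axis i 1)) $ j \<in> \<int>"
      using rational_multiple_integer by blast
    then have "real N *\<^sub>R p (axis i 1) \<in> ?I" using pL subL by (auto simp: subspace_scale)
    then have "(1 / real N) *\<^sub>R (real N *\<^sub>R p (axis i 1)) \<in> span ?I" by (intro span_scale span_base)
    then show ?thesis using N by simp
  qed
  have "x \<in> span ?I" if "x \<in> L" for x
  proof -
    have "x = p (\<Sum>i\<in>UNIV. (x $ i) *\<^sub>R axis i 1)"
      using p_id[OF that] basis_expansion[of x] by (simp add: scalar_mult_eq_scaleR)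
    also have "\<dots> = (\<Sum>i\<in>UNIV. (x $ i) *\<^sub>R p (axis i 1))"
      using lin by (simp add: linear_sum linear_scale)
    also have "\<dots> \<in> span ?I" by (intro span_sum span_scale pe)
    finally show ?thesis .
  qed
  moreover have "span ?I \<subseteq> L" using subL by (intro span_minimal) auto
  ultimately show ?thesis by blast
qed

text \<open>A fundamental parallelepiped of the sublattice generated by a basis contained in the lattice
  covers the subspace with constant multiplicity; no basis of the full lattice is needed.\<close>
lemma lattice_multi_tile:
  fixes \<Lambda> L :: "'a::euclidean_space set"
  assumes \<Lambda>0: "0 \<in> \<Lambda>" and diff: "\<And>x y. x \<in> \<Lambda> \<Longrightarrow> y \<in> \<Lambda> \<Longrightarrow> x - y \<in> \<Lambda>"
    and discrete: "\<And>S. bounded S \<Longrightarrow> finite (\<Lambda> \<inter> S)"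
    and L: "span \<Lambda> = L"
  obtains U and \<kappa> :: nat where "U \<in> sets borel" "bounded U" "\<kappa> > 0"
    "\<And>z. z \<in> L \<Longrightarrow> finite {l \<in> \<Lambda>. z - l \<in> U} \<and> card {l \<in> \<Lambda>. z - l \<in> U} = \<kappa>"
proof -
  have neg: "- x \<in> \<Lambda>" if "x \<in> \<Lambda>" for x using diff[OF \<Lambda>0 that] by simp
  have add: "x + y \<in> \<Lambda>" if "x \<in> \<Lambda>" "y \<in> \<Lambda>" for x y using diff[OF that(1) neg[OF that(2)]] by simp
  have nat_mult: "real n *\<^sub>R x \<in> \<Lambda>" if "x \<in> \<Lambda>" for n x
    using that by (induction n) (auto simp: \<Lambda>0 add scaleR_left_distrib)
  have int_mult: "real_of_int i *\<^sub>R x \<in> \<Lambda>" if "x \<in> \<Lambda>" for i x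
    using nat_mult[OF that, of "nat i"] neg[OF nat_mult[OF that, of "nat (-i)"]]
    by (cases "i \<ge> 0") auto
  have sum_in: "(\<Sum>b\<in>A. f b) \<in> \<Lambda>" if "\<And>b. b \<in> A \<Longrightarrow> f b \<in> \<Lambda>" for A and f :: "'a \<Rightarrow> 'a"
    using that by (induction A rule: infinite_finite_induct) (auto simp: \<Lambda>0 add)
  obtain B where B: "B \<subseteq> \<Lambda>" "independent B" "\<Lambda> \<subseteq> span B"
    using maximal_independent_subset[of \<Lambda>] by blast
  have spanB: "span B = L"
    using B L by (metis span_mono span_minimal subspace_span subset_antisym)
  have finB: "finite B" using B(2) by (rule independent_imp_finite)
  \<comment> \<open>Extending \<open>B\<close> to the whole space makes the coordinate functionals
    linear everywhere, hence continuous, which gives measurability of the cell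
    \<open>U\<close>.\<close>
  define E where "E = extend_basis B"
  have E: "independent E" "span E = UNIV" "B \<subseteq> E"
    using B(2) by (auto simp: E_def independent_extend_basis span_extend_basis extend_basis_superset)
  define \<phi> where "\<phi> b x = representation E x b" for b x
  have lin: "linear (\<phi> b)" for b
    unfolding \<phi>_def using E by (intro linearI) (simp_all add: representation_add representation_scale)
  have \<phi>B: "\<phi> b b' = (if b = b' then 1 else 0)" if "b' \<in> B" for b b'
    unfolding \<phi>_def using representation_basis[OF E(1), of b'] that E(3) by auto
  have \<phi>sum: "\<phi> b (\<Sum>b'\<in>B. f b' *\<^sub>R b') = f b" if "b \<in> B" for b f
  proof -
    have "\<phi> b (\<Sum>b'\<in>B. f b' *\<^sub>R b') = (\<Sum>b'\<in>B. f b' * \<phi> b b')"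
      using lin[of b] by (simp add: linear_sum linear_scale)
    also have "\<dots> = f b" using that finB by (simp add: \<phi>B if_distrib cong: if_cong sum.cong)
    finally show ?thesis .
  qed
  have expand: "(\<Sum>b\<in>B. \<phi> b x *\<^sub>R b) = x" if "x \<in> L" for x
  proof -
    have "x \<in> range (\<lambda>f. \<Sum>b\<in>B. f b *\<^sub>R b)"
      using that unfolding spanB[symmetric] span_finite[OF finB] .
    then obtain f where f: "x = (\<Sum>b\<in>B. f b *\<^sub>R b)" by blast
    then show ?thesis by (simp add: \<phi>sum cong: sum.cong)
  qed
  have subL: "subspace L" using L by auto
  define U where "U = {x \<in> L. \<forall>b\<in>B. 0 \<le> \<phi> b x \<and> \<phi> b x < 1}"
  \<comment> \<open>Reduction modulo the sublattice generated by \<open>B\<close>: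
    \<open>fr x\<close> is the representative of \<open>x\<close> in the half-open cell
    \<open>U\<close>.\<close>
  define fr where "fr x = (\<Sum>b\<in>B. frac (\<phi> b x) *\<^sub>R b)" for x
  have frU: "fr x \<in> U" for x
  proof -
    have "fr x \<in> L" unfolding fr_def spanB[symmetric] by (intro span_sum span_scale span_base)
    then show ?thesis by (auto simp: U_def fr_def \<phi>sum frac_lt_1)
  qed
  have diff_fr: "x - fr x = (\<Sum>b\<in>B. of_int \<lfloor>\<phi> b x\<rfloor> *\<^sub>R b)" if "x \<in> L" for x
  proof -
    have "x - fr x = (\<Sum>b\<in>B. \<phi> b x *\<^sub>R b) - fr x" using expand[OF that] by simp
    also have "\<dots> = (\<Sum>b\<in>B. of_int \<lfloor>\<phi> b x\<rfloor> *\<^sub>R b)"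
      unfolding fr_def sum_subtractf[symmetric] by (simp add: frac_def scaleR_left_diff_distrib)
    finally show ?thesis .
  qed
  have diff_fr_in: "x - fr x \<in> \<Lambda>" if "x \<in> L" for x
    unfolding diff_fr[OF that] using B(1) by (intro sum_in int_mult) auto
  have fr_id: "fr x = x" if "x \<in> U" for x
  proof -
    have "frac (\<phi> b x) = \<phi> b x" if "b \<in> B" for b
      using \<open>x \<in> U\<close> that by (auto simp: U_def frac_eq)
    then show ?thesis using expand[of x] that by (simp add: fr_def U_def)
  qed
  have fr_shift: "fr (x + (y - fr y)) = fr x" if "y \<in> L" for x y
  proof -
    have "frac (\<phi> b (x + (y - fr y))) = frac (\<phi> b x)" if "b \<in> B" for b
    proof -
      have "\<phi> b (x + (y - fr y)) = \<phi> b x + of_int \<lfloor>\<phi> b y\<rfloor>"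
        unfolding diff_fr[OF \<open>y \<in> L\<close>] using \<phi>sum[OF that] lin[of b] by (simp add: linear_add)
      then show ?thesis by (simp add: frac_def)
    qed
    then show ?thesis by (simp add: fr_def)
  qed
  have \<Lambda>L: "\<Lambda> \<subseteq> L" using L span_superset by blast
  have bU: "bounded U"
  proof -
    have "norm x \<le> (\<Sum>b\<in>B. norm b)" if "x \<in> U" for x
    proof -
      have "norm x = norm (\<Sum>b\<in>B. \<phi> b x *\<^sub>R b)" using expand[of x] that by (simp add: U_def)
      also have "\<dots> \<le> (\<Sum>b\<in>B. norm (\<phi> b x *\<^sub>R b))" by (rule norm_sum)
      also have "\<dots> \<le> (\<Sum>b\<in>B. norm b)"
      proof (rule sum_mono)
        fix b assume "b \<in> B"
        then have "\<bar>\<phi> b x\<bar> \<le> 1" using that by (auto simp: U_def)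
        then show "norm (\<phi> b x *\<^sub>R b) \<le> norm b" using mult_right_mono[of "\<bar>\<phi> b x\<bar>" 1 "norm b"] by simp
      qed
      finally show ?thesis .
    qed
    then show ?thesis by (auto simp: bounded_iff)
  qed
  show ?thesis
  proof (rule that[of U "card (\<Lambda> \<inter> U)"])
    show "U \<in> sets borel"
    proof -
      have [measurable]: "\<phi> b \<in> borel_measurable borel" for b
        using linear_continuous_on[of "\<phi> b" UNIV] lin[of b]
        by (auto intro!: borel_measurable_continuous_onI simp: linear_conv_bounded_linear)
      have [measurable]: "L \<in> sets borel" using closed_subspace[OF subL] by simp
      have "{x \<in> space borel. x \<in> L \<and> (\<forall>b\<in>B. 0 \<le> \<phi> b x \<and> \<phi> b x < 1)} \<in> sets borel"
        using finB by measurable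
      then show ?thesis by (simp add: U_def)
    qed
    show "bounded U" by fact
    have "0 \<in> U" using subL lin by (auto simp: U_def subspace_0 linear_0)
    then show "card (\<Lambda> \<inter> U) > 0" using \<Lambda>0 discrete[OF bU] by (auto simp: card_gt_0_iff)
    fix z assume z: "z \<in> L"
    \<comment> \<open>The lattice points of \<open>U\<close> represent the cosets of the sublattice
      generated by \<open>B\<close>. Each coset contains exactly one l with z - l in
      \<open>U\<close>, so the multiplicity is the index of that sublattice, whatever z is.\<close>
    have "bij_betw (\<lambda>c. z - fr (z - c)) (\<Lambda> \<inter> U) {l \<in> \<Lambda>. z - l \<in> U}"
    proof (rule bij_betw_byWitness[where f' = fr])
      show "\<forall>c\<in>\<Lambda> \<inter> U. fr (z - fr (z - c)) = c"
      proof
        fix c assume c: "c \<in> \<Lambda> \<inter> U"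
        then have "z - c \<in> L" using z \<Lambda>L subL by (auto intro: subspace_diff)
        from fr_shift[OF this, of c] show "fr (z - fr (z - c)) = c"
          using fr_id[of c] c by (simp add: algebra_simps)
      qed
      show "\<forall>l\<in>{l \<in> \<Lambda>. z - l \<in> U}. z - fr (z - fr l) = l"
      proof
        fix l assume l: "l \<in> {l \<in> \<Lambda>. z - l \<in> U}"
        then have "fr ((z - l) + (l - fr l)) = z - l"
          using fr_shift[of l "z - l"] fr_id[of "z - l"] \<Lambda>L by auto
        then show "z - fr (z - fr l) = l" by (simp add: algebra_simps)
      qed
      show "(\<lambda>c. z - fr (z - c)) ` (\<Lambda> \<inter> U) \<subseteq> {l \<in> \<Lambda>. z - l \<in> U}"
      proof (rule image_subsetI)
        fix c assume c: "c \<in> \<Lambda> \<inter> U"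
        then have "z - c \<in> L" using z \<Lambda>L subL by (auto intro: subspace_diff)
        from add[OF diff_fr_in[OF this], of c] show "z - fr (z - c) \<in> {l \<in> \<Lambda>. z - l \<in> U}"
          using c frU by (simp add: algebra_simps)
      qed
      show "fr ` {l \<in> \<Lambda>. z - l \<in> U} \<subseteq> \<Lambda> \<inter> U"
      proof (rule image_subsetI)
        fix l assume "l \<in> {l \<in> \<Lambda>. z - l \<in> U}"
        then have l: "l \<in> \<Lambda>" by simp
        from diff[OF l diff_fr_in[OF subsetD[OF \<Lambda>L l]]] show "fr l \<in> \<Lambda> \<inter> U"
          using frU by simp
      qed
    qed
    from bij_betw_finite[OF this] bij_betw_same_card[OF this] discrete[OF bU]
    show "finite {l \<in> \<Lambda>. z - l \<in> U} \<and> card {l \<in> \<Lambda>. z - l \<in> U} = card (\<Lambda> \<inter> U)" by simp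
  qed
qed

section \<open>Riemann sums over a lattice in a subspace\<close>

lemma emeasure_subspace_lebesgue_bounded:
  fixes L :: "'a::euclidean_space set"
  assumes L: "subspace L" and U: "U \<in> sets borel" "bounded U"
  shows "emeasure (subspace_lebesgue L) U < \<infinity>"
proof -
  obtain D where D: "\<And>x. x \<in> U \<Longrightarrow> norm x \<le> D" using U(2) by (auto simp: bounded_iff)
  have "integrable (subspace_lebesgue L) (\<lambda>x. exp D * exp (- 1 * norm x))"
    using integrable_exp_norm_subspace[OF L, of 1] by simp
  then have "(\<integral>\<^sup>+x. ennreal (norm (exp D * exp (- 1 * norm x))) \<partial>subspace_lebesgue L) < \<infinity>"
    unfolding integrable_iff_bounded by blast
  then have int: "(\<integral>\<^sup>+x. ennreal (exp D * exp (- 1 * norm x)) \<partial>subspace_lebesgue L) < \<infinity>"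
    by (simp only: real_norm_def abs_mult abs_exp_cancel)
  have "emeasure (subspace_lebesgue L) U = (\<integral>\<^sup>+x. indicator U x \<partial>subspace_lebesgue L)"
    using U by simp
  also have "\<dots> \<le> (\<integral>\<^sup>+x. ennreal (exp D * exp (- 1 * norm x)) \<partial>subspace_lebesgue L)"
  proof (rule nn_integral_mono)
    fix x
    show "indicator U x \<le> ennreal (exp D * exp (- 1 * norm x))"
      using D[of x] by (auto simp: indicator_def exp_add[symmetric] one_le_exp_iff ennreal_1[symmetric] simp del: ennreal_1 intro!: ennreal_leI)
  qed
  finally show ?thesis using int by (rule le_less_trans)
qed

lemma measure_subspace_lebesgue_affine:
  fixes L :: "'a::euclidean_space set"
  assumes L: "subspace L" and z: "z \<in> L" and s: "s \<noteq> 0" and U: "U \<in> sets borel"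
  shows "measure (subspace_lebesgue L) ((\<lambda>x. z + s *\<^sub>R x) -` U) = measure (subspace_lebesgue L) U / \<bar>s\<bar> ^ dim L"
proof -
  have "emeasure (subspace_lebesgue L) U =
     ennreal (\<bar>s\<bar> ^ dim L) * emeasure (subspace_lebesgue L) ((\<lambda>x. z + s *\<^sub>R x) -` U)"
    by (subst subspace_lebesgue_affine[OF L z s]) (simp add: emeasure_density_const emeasure_distr U)
  then have "measure (subspace_lebesgue L) U =
     \<bar>s\<bar> ^ dim L * measure (subspace_lebesgue L) ((\<lambda>x. z + s *\<^sub>R x) -` U)"
    by (simp add: measure_def enn2real_mult)
  then show ?thesis using s by simp
qed

text \<open>The sum is turned exactly into an integral: \<open>H k u\<close> adds
  \<open>F k l\<close> over the lattice points l whose cell l + U contains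
  \<open>s k + \<sigma> k *\<^sub>R u\<close>, and integrating the indicators produces the volume
  factor. Every u in \<open>L\<close> is covered \<kappa> times by cells that shrink like 1 /
  \<sigma>, so \<open>H k\<close> tends pointwise to \<kappa> times \<open>G\<close>, and dominated
  convergence applies. Convergence of \<open>F\<close> is required only along sequences of lattice
  points.\<close>

lemma lattice_riemann_sum:
  fixes L \<Lambda> :: "'a::euclidean_space set" and F :: "nat \<Rightarrow> 'a \<Rightarrow> 'b::{banach, second_countable_topology}"
    and \<kappa> :: nat
  assumes L: "subspace L" and U: "U \<in> sets borel" "bounded U"
    and \<Lambda>: "\<Lambda> \<subseteq> L"
    and tile: "\<And>z. z \<in> L \<Longrightarrow> finite {l \<in> \<Lambda>. z - l \<in> U} \<and> card {l \<in> \<Lambda>. z - l \<in> U} = \<kappa>" "\<kappa> > 0"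
    and \<sigma>: "\<And>k. \<sigma> k \<ge> 1" "filterlim \<sigma> at_top sequentially" and s: "\<And>k. s k \<in> L"
    and S: "\<And>k. finite (S k)" "\<And>k. S k \<subseteq> \<Lambda>" "\<And>k l. l \<in> \<Lambda> \<Longrightarrow> l \<notin> S k \<Longrightarrow> F k l = 0"
    and c: "c > 0"
    and bound: "\<And>k l. l \<in> \<Lambda> \<Longrightarrow> norm (F k l) \<le> C * exp (- c * norm ((l - s k) /\<^sub>R \<sigma> k))"
    and lim: "\<And>u l. u \<in> L \<Longrightarrow> (\<And>k. l k \<in> \<Lambda>) \<Longrightarrow> (\<lambda>k. (l k - s k) /\<^sub>R \<sigma> k) \<longlonglongrightarrow> u
        \<Longrightarrow> (\<lambda>k. F k (l k)) \<longlonglongrightarrow> G u"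
    and G: "G \<in> borel_measurable borel"
  shows "(\<lambda>k. (measure (subspace_lebesgue L) U / \<sigma> k ^ dim L) *\<^sub>R (\<Sum>l\<in>S k. F k l))
     \<longlonglongrightarrow> real \<kappa> *\<^sub>R (\<integral>u. G u \<partial>subspace_lebesgue L)"
proof -
  let ?M = "subspace_lebesgue L"
  note G[measurable]
  obtain D where D: "\<And>x. x \<in> U \<Longrightarrow> norm x \<le> D" using U(2) by (auto simp: bounded_iff)
  have \<sigma>0: "\<sigma> k > 0" for k using \<sigma>(1)[of k] by simp
  define A where "A k u = {l \<in> \<Lambda>. (s k + \<sigma> k *\<^sub>R u) - l \<in> U}" for k u
  have A: "finite (A k u)" "card (A k u) = \<kappa>" if "u \<in> L" for k u
    using tile(1)[of "s k + \<sigma> k *\<^sub>R u"] that s L by (auto simp: A_def subspace_add subspace_scale)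
  define H where "H k u = (\<Sum>l\<in>S k. indicator U ((s k - l) + \<sigma> k *\<^sub>R u) *\<^sub>R F k l)" for k u
  have zL: "s k - l \<in> L" if "l \<in> S k" for k l 
    by (rule subspace_diff[OF L s]) (use that S(2) \<Lambda> in blast)
  have [measurable]: "H k \<in> borel_measurable ?M" for k
    unfolding H_def using U(1) by measurable
  have int_ind: "(\<integral>u. indicator U ((s k - l) + \<sigma> k *\<^sub>R u) \<partial>?M) = measure ?M U / \<sigma> k ^ dim L"
    "integrable ?M (\<lambda>u. indicator U ((s k - l) + \<sigma> k *\<^sub>R u) :: real)" if "l \<in> S k" for k l
  proof -
    let ?V = "(\<lambda>x. (s k - l) + \<sigma> k *\<^sub>R x) -` U"
    have ind: "(\<lambda>u. indicator U ((s k - l) + \<sigma> k *\<^sub>R u)) = (indicator ?V :: _ \<Rightarrow> real)"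
      by (auto simp: fun_eq_iff indicator_def)
    have V: "?V \<in> sets borel"
      using measurable_sets[of "\<lambda>x. (s k - l) + \<sigma> k *\<^sub>R x" borel borel U] U(1) by simp
    have "measure ?M ?V = measure ?M U / \<sigma> k ^ dim L"
      using measure_subspace_lebesgue_affine[OF L zL[OF that] _ U(1), of "\<sigma> k"] \<sigma>0[of k] by simp
    then show "(\<integral>u. indicator U ((s k - l) + \<sigma> k *\<^sub>R u) \<partial>?M) = measure ?M U / \<sigma> k ^ dim L"
      unfolding ind by simp
    have "bounded ?V"
    proof -
      have "norm u \<le> (D + norm (s k - l)) / \<sigma> k" if "u \<in> ?V" for u
      proof -
        have "norm (\<sigma> k *\<^sub>R u) \<le> norm ((s k - l) + \<sigma> k *\<^sub>R u) + norm (s k - l)"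
          using norm_triangle_ineq4[of "(s k - l) + \<sigma> k *\<^sub>R u" "s k - l"] by simp
        then have "\<sigma> k * norm u \<le> D + norm (s k - l)" using D[of "(s k - l) + \<sigma> k *\<^sub>R u"] that \<sigma>0[of k] by simp
        then show ?thesis using \<sigma>0[of k] by (simp add: pos_le_divide_eq mult.commute)
      qed
      then show ?thesis unfolding bounded_iff by blast
    qed
    from emeasure_subspace_lebesgue_bounded[OF L V this] V
    show "integrable ?M (\<lambda>u. indicator U ((s k - l) + \<sigma> k *\<^sub>R u) :: real)"
      unfolding ind by simp
  qed
  have int_H: "(\<integral>u. H k u \<partial>?M) = (measure ?M U / \<sigma> k ^ dim L) *\<^sub>R (\<Sum>l\<in>S k. F k l)" for k
  proof -
    have "(\<integral>u. H k u \<partial>?M) = (\<Sum>l\<in>S k. (\<integral>u. indicator U ((s k - l) + \<sigma> k *\<^sub>R u) *\<^sub>R F k l \<partial>?M))"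
      unfolding H_def by (rule Bochner_Integration.integral_sum) (intro integrable_scaleR_left int_ind)
    also have "\<dots> = (\<Sum>l\<in>S k. (measure ?M U / \<sigma> k ^ dim L) *\<^sub>R F k l)"
      by (intro sum.cong refl) (simp add: int_ind integral_scaleR_left)
    finally show ?thesis by (simp add: scaleR_sum_right)
  qed
  have H_eq: "H k u = (\<Sum>l\<in>A k u. F k l)" if u: "u \<in> L" for k u
  proof -
    have "H k u = (\<Sum>l\<in>S k. if l \<in> A k u then F k l else 0)"
      unfolding H_def using S(2) by (intro sum.cong refl) (auto simp: A_def indicator_def algebra_simps)
    also have "\<dots> = (\<Sum>l\<in>S k \<inter> A k u. F k l)" using S(1) by (simp add: sum.inter_restrict)
    also have "\<dots> = (\<Sum>l\<in>A k u. F k l)"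
      by (rule sum.mono_neutral_left) (use A[OF u] S(3) in \<open>auto simp: A_def\<close>)
    finally show ?thesis .
  qed
  have near: "norm ((l - s k) /\<^sub>R \<sigma> k - u) \<le> D / \<sigma> k" if "l \<in> A k u" for k u l
  proof -
    have eq: "(l - s k) /\<^sub>R \<sigma> k - u = - (((s k + \<sigma> k *\<^sub>R u) - l) /\<^sub>R \<sigma> k)"
      using \<sigma>0[of k] by (simp add: algebra_simps)
    have "norm ((s k + \<sigma> k *\<^sub>R u) - l) \<le> D" using that D by (auto simp: A_def)
    then have "norm ((s k + \<sigma> k *\<^sub>R u) - l) / \<sigma> k \<le> D / \<sigma> k"
      using \<sigma>0[of k] by (intro divide_right_mono) auto
    then show ?thesis unfolding eq norm_minus_cancel norm_scaleR
      using \<sigma>0[of k] by (simp add: divide_inverse mult.commute)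
  qed
  have Ane: "A k u \<noteq> {}" if "u \<in> L" for k u using A[OF that, of k] tile(2) by auto
  have "0 \<in> L" using L by (rule subspace_0)
  then obtain l0 where l0: "l0 \<in> A 0 0" using Ane by blast
  have "0 \<le> C * exp (- c * norm ((l0 - s 0) /\<^sub>R \<sigma> 0))"
    by (rule order_trans[OF norm_ge_zero bound]) (use l0 in \<open>simp add: A_def\<close>)
  then have C0: "C \<ge> 0" by (simp add: zero_le_mult_iff)
  have "norm (s 0 - l0) \<le> D" using l0 D by (simp add: A_def)
  then have D0: "D \<ge> 0" by (rule order_trans[OF norm_ge_zero])
  have H_bound: "norm (H k u) \<le> (real \<kappa> * (C * exp (c * D))) * exp (- c * norm u)" if u: "u \<in> L" for k u
  proof -
    have "norm (F k l) \<le> C * (exp (c * D) * exp (- c * norm u))" if l: "l \<in> A k u" for l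
    proof -
      have "norm u \<le> norm ((l - s k) /\<^sub>R \<sigma> k) + D / \<sigma> k"
        using near[OF l] norm_triangle_ineq4[of "(l - s k) /\<^sub>R \<sigma> k" "(l - s k) /\<^sub>R \<sigma> k - u"] by simp
      \<comment> \<open>Because \<sigma> is at least 1, passing from l to u moves the rescaled point
        by at most \<open>D\<close> uniformly in k; this costs the factor \<open>exp (c * D)\<close>
        in the dominating function.\<close>
      moreover have "D / \<sigma> k \<le> D" using mult_left_mono[OF \<sigma>(1)[of k] D0] \<sigma>0[of k] by (simp add: divide_le_eq)
      ultimately have "norm u \<le> norm ((l - s k) /\<^sub>R \<sigma> k) + D" by linarith
      then have "c * norm u \<le> c * (norm ((l - s k) /\<^sub>R \<sigma> k) + D)" using c by (intro mult_left_mono) auto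
      then have "exp (- c * norm ((l - s k) /\<^sub>R \<sigma> k)) \<le> exp (c * D) * exp (- c * norm u)"
        unfolding exp_add[symmetric] exp_le_cancel_iff distrib_left by linarith
      then have "C * exp (- c * norm ((l - s k) /\<^sub>R \<sigma> k)) \<le> C * (exp (c * D) * exp (- c * norm u))"
        using C0 by (rule mult_left_mono)
      moreover have "l \<in> \<Lambda>" using l by (simp add: A_def)
      ultimately show ?thesis using bound[of l k] by linarith
    qed
    then have "(\<Sum>l\<in>A k u. norm (F k l)) \<le> real (card (A k u)) * (C * (exp (c * D) * exp (- c * norm u)))"
      by (rule sum_bounded_above)
    then show ?thesis unfolding H_eq[OF u] A(2)[OF u] using norm_sum[of "F k" "A k u"] by (simp add: mult.assoc)
  qed
  have H_lim: "(\<lambda>k. H k u) \<longlonglongrightarrow> real \<kappa> *\<^sub>R G u" if u: "u \<in> L" for u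
  proof -
    \<comment> \<open>Choosing for each k the lattice point with the largest error reduces the sum
      over \<kappa> points to one sequence, to which the assumption \<open>lim\<close>
      applies.\<close>
    have "\<exists>l\<in>A k u. \<forall>l'\<in>A k u. norm (F k l' - G u) \<le> norm (F k l - G u)" for k
    proof -
      have "Max ((\<lambda>l. norm (F k l - G u)) ` A k u) \<in> (\<lambda>l. norm (F k l - G u)) ` A k u"
        using A(1)[OF u, of k] Ane[OF u, of k] by (intro Max_in) auto
      then obtain l where "l \<in> A k u" "norm (F k l - G u) = Max ((\<lambda>l. norm (F k l - G u)) ` A k u)" by auto
      then show ?thesis using A(1)[OF u, of k] by (intro bexI[of _ l]) auto
    qed
    then have "\<forall>k. \<exists>l. l \<in> A k u \<and> (\<forall>l'\<in>A k u. norm (F k l' - G u) \<le> norm (F k l - G u))" by blast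
    from choice[OF this] obtain l where l: "\<And>k. l k \<in> A k u"
      "\<And>k l'. l' \<in> A k u \<Longrightarrow> norm (F k l' - G u) \<le> norm (F k (l k) - G u)" by blast
    have "(\<lambda>k. (l k - s k) /\<^sub>R \<sigma> k - u) \<longlonglongrightarrow> 0"
    proof (rule Lim_null_comparison)
      show "\<forall>\<^sub>F k in sequentially. norm ((l k - s k) /\<^sub>R \<sigma> k - u) \<le> D / \<sigma> k" using near l(1) by simp
      show "(\<lambda>k. D / \<sigma> k) \<longlonglongrightarrow> 0"
        by (rule tendsto_divide_0[OF tendsto_const]) (use \<sigma>(2) filterlim_at_top_imp_at_infinity in blast)
    qed
    then have "(\<lambda>k. (l k - s k) /\<^sub>R \<sigma> k) \<longlonglongrightarrow> u" by (simp add: LIM_zero_iff)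
    moreover have "l k \<in> \<Lambda>" for k using l(1)[of k] by (simp add: A_def)
    ultimately have Fl: "(\<lambda>k. F k (l k)) \<longlonglongrightarrow> G u" using lim[OF u] by blast
    have "(\<lambda>k. H k u - real \<kappa> *\<^sub>R G u) \<longlonglongrightarrow> 0"
    proof (rule Lim_null_comparison)
      show "(\<lambda>k. real \<kappa> * norm (F k (l k) - G u)) \<longlonglongrightarrow> 0"
        using tendsto_mult[OF tendsto_const tendsto_norm[OF LIM_zero[OF Fl]]] by simp
      show "\<forall>\<^sub>F k in sequentially. norm (H k u - real \<kappa> *\<^sub>R G u) \<le> real \<kappa> * norm (F k (l k) - G u)"
      proof (rule always_eventually, rule allI)
        fix k
        have "H k u - real \<kappa> *\<^sub>R G u = (\<Sum>l'\<in>A k u. (F k l' - G u))"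
          unfolding H_eq[OF u] using A[OF u, of k] by (simp add: sum_subtractf sum_constant_scaleR)
        then have "norm (H k u - real \<kappa> *\<^sub>R G u) \<le> (\<Sum>l'\<in>A k u. norm (F k l' - G u))"
          by (simp add: norm_sum)
        also have "\<dots> \<le> real (card (A k u)) * norm (F k (l k) - G u)"
          using l(2) by (rule sum_bounded_above)
        finally show "norm (H k u - real \<kappa> *\<^sub>R G u) \<le> real \<kappa> * norm (F k (l k) - G u)"
          using A(2)[OF u] by simp
      qed
    qed
    then show ?thesis by (simp add: LIM_zero_iff)
  qed
  have "(\<lambda>k. integral\<^sup>L ?M (H k)) \<longlonglongrightarrow> integral\<^sup>L ?M (\<lambda>u. real \<kappa> *\<^sub>R G u)"
  proof (rule integral_dominated_convergence)
    show "integrable ?M (\<lambda>u. (real \<kappa> * (C * exp (c * D))) * exp (- c * norm u))"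
      using integrable_exp_norm_subspace[OF L c] by (rule integrable_mult_right)
    show "AE u in ?M. (\<lambda>k. H k u) \<longlonglongrightarrow> real \<kappa> *\<^sub>R G u"
      using AE_subspace_lebesgue[OF L] by eventually_elim (rule H_lim)
    show "AE u in ?M. norm (H k u) \<le> (real \<kappa> * (C * exp (c * D))) * exp (- c * norm u)" for k
      using AE_subspace_lebesgue[OF L] by eventually_elim (rule H_bound)
  qed measurable
  then show ?thesis by (simp add: int_H)
qed

section \<open>The minimizer of the potential\<close>

text \<open>Tangent line at x to the convex function t ln t, rearranged; with
  \<open>ln 0 = 0\<close> it holds at y = 0 too. Summed over coordinates it becomes the
  nonnegativity of a relative entropy.\<close>

lemma xlnx_tangent:
  fixes x y :: real
  assumes "x > 0" "y \<ge> 0"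
  shows "y - x \<le> y * ln y - y * ln x"
proof (cases "y = 0")
  case False
  with assms have y: "y > 0" by simp
  have "ln (x / y) \<le> x / y - 1" using assms y by (intro ln_le_minus_one) simp
  then have "y * ln (x / y) \<le> y * (x / y - 1)" using y by (intro mult_left_mono) auto
  then show ?thesis using y assms by (simp add: ln_div algebra_simps)
qed (use assms in simp)

text \<open>The equality case, from ln t = t - 1 only at t = 1.\<close>

lemma xlnx_tangent_eq:
  fixes x y :: real
  assumes "x > 0" "y \<ge> 0" "y * ln y - y * ln x \<le> y - x"
  shows "y = x"
proof (cases "y = 0")
  case True
  then show ?thesis using assms by simp
next
  case False
  with assms have y: "y > 0" by simp
  have "y * ln (x / y) \<ge> y * (x / y - 1)" using y assms by (simp add: ln_div algebra_simps)
  then have "ln (x / y) \<ge> x / y - 1" using y by (simp only: mult_le_cancel_left_pos)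
  moreover have "ln (x / y) \<le> x / y - 1" using assms y by (intro ln_le_minus_one) simp
  ultimately have "x / y = 1" using assms y by (intro ln_eq_minus_one) auto
  then show ?thesis using y by simp
qed

text \<open>Averaging the tangent inequalities at the intermediate point cancels the linear parts.
  The intermediate point 0 is treated apart, since no tangent exists there.\<close>

lemma xlnx_convex:
  fixes a b s :: real
  assumes "a \<ge> 0" "b \<ge> 0" "0 < s" "s < 1"
  shows "((1 - s) * a + s * b) * ln ((1 - s) * a + s * b) \<le> (1 - s) * (a * ln a) + s * (b * ln b)"
proof -
  define x where "x = (1 - s) * a + s * b"
  have nn: "(1 - s) * a \<ge> 0" "s * b \<ge> 0" using assms by auto
  show ?thesis
  proof (cases "x = 0")
    case True
    then have "(1 - s) * a = 0" "s * b = 0" using nn unfolding x_def by linarith+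
    then show ?thesis using assms by auto
  next
    case False
    then have x: "x > 0" using nn unfolding x_def by linarith
    have "(1 - s) * (a - x) \<le> (1 - s) * (a * ln a - a * ln x)"
      using xlnx_tangent[OF x assms(1)] assms by (intro mult_left_mono) auto
    moreover have "s * (b - x) \<le> s * (b * ln b - b * ln x)"
      using xlnx_tangent[OF x assms(2)] assms by (intro mult_left_mono) auto
    moreover have "(1 - s) * (a - x) + s * (b - x) = 0" by (simp add: x_def algebra_simps)
    moreover have "(1 - s) * (a * ln a - a * ln x) + s * (b * ln b - b * ln x)
       = (1 - s) * (a * ln a) + s * (b * ln b) - x * ln x"
      by (simp add: x_def algebra_simps)
    ultimately show ?thesis unfolding x_def[symmetric] by linarith
  qed
qed

lemma continuous_on_xlnx: "continuous_on {0..} (\<lambda>t::real. t * ln t)"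
  unfolding continuous_on_def
proof
  fix x :: real assume x: "x \<in> {0..}"
  show "((\<lambda>t. t * ln t) \<longlongrightarrow> x * ln x) (at x within {0..})"
  proof (cases "x = 0")
    case False
    then show ?thesis using x by (auto intro!: tendsto_eq_intros)
  next
    case True
    \<comment> \<open>Applying ln u \<le> u - 1 at u = 1 / sqrt t, instead of at 1 / t, leaves a
      bound that still vanishes at 0.\<close>
    have bound: "norm (t * ln t) \<le> 2 * sqrt t" if "0 \<le> t" "t < 1" for t :: real
    proof (cases "t = 0")
      case False
      with that have t: "t > 0" by simp
      have "ln (1 / sqrt t) \<le> 1 / sqrt t - 1" using t by (intro ln_le_minus_one) simp
      then have "- ln t / 2 \<le> 1 / sqrt t" using t by (simp add: ln_div ln_sqrt)
      then have "t * (- ln t / 2) \<le> t * (1 / sqrt t)" using t by (intro mult_left_mono) auto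
      also have "t * (1 / sqrt t) = sqrt t" using t by (simp add: real_div_sqrt)
      finally have "- (t * ln t) \<le> 2 * sqrt t" by simp
      moreover have "t * ln t \<le> 0" using t that by (simp add: mult_nonneg_nonpos)
      ultimately show ?thesis by simp
    qed simp
    have "((\<lambda>t. t * ln t) \<longlongrightarrow> 0) (at 0 within {0::real..})"
    proof (rule Lim_null_comparison)
      have "\<forall>\<^sub>F t in at 0 within {0::real..}. t < 1"
        by (rule order_tendstoD(2)[OF tendsto_ident_at]) simp
      moreover have "\<forall>\<^sub>F t in at 0 within {0::real..}. t \<in> {0..}"
        by (simp add: eventually_at_topological) blast
      ultimately show "\<forall>\<^sub>F t in at 0 within {0::real..}. norm (t * ln t) \<le> 2 * sqrt t"
        by eventually_elim (simp only: bound atLeast_iff)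
      have "((\<lambda>t. 2 * sqrt t) \<longlongrightarrow> 2 * sqrt 0) (at 0 within {0::real..})"
        by (intro tendsto_intros)
      then show "((\<lambda>t. 2 * sqrt t) \<longlongrightarrow> 0) (at 0 within {0::real..})" by simp
    qed
    then show ?thesis using True by simp
  qed
qed

section \<open>The polytope, its relative interior and the minimizer\<close>

locale polyhedral_multinomial =
  fixes r :: nat and v :: "nat \<Rightarrow> real^'n" and a :: "nat \<Rightarrow> int"
  assumes r: "r \<ge> 1"
    and int_v: "\<And>i j. i < r \<Longrightarrow> v i $ j \<in> \<int>"
    and sum_v: "(\<Sum>i<r. v i) = 0"
    and compact_P: "compact (polyhedron r v a)"
    and facets: "\<And>i. i < r \<Longrightarrow> \<exists>x\<in>polyhedron r v a. v i \<bullet> x + of_int (a i) = 0"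
    and support_nonempty: "\<And>k::nat. k \<ge> 1 \<Longrightarrow> pm_support r v (\<lambda>i. int k * a i) \<noteq> {}"
begin

definition P where "P = polyhedron r v a"
definition I where "I = nonconst_idx r v a"
definition L where "L = diff_space P"
definition slack where "slack i x = v i \<bullet> x + of_int (a i)"
text \<open>On \<open>P\<close> this is the logarithm of the potential; \<open>0 * ln 0 = 0\<close>
  matches the convention 0^0 = 1.\<close>

definition entropy where "entropy x = (\<Sum>i<r. slack i x * ln (slack i x))"
definition m where "m = min_point r v a"

lemma P_iff: "x \<in> P \<longleftrightarrow> (\<forall>i<r. slack i x \<ge> 0)"
  by (auto simp: P_def polyhedron_def slack_def)

lemma I_less: "i \<in> I \<Longrightarrow> i < r" by (simp add: I_def nonconst_idx_def)

lemma finite_I: "finite I" using I_less by (auto intro: finite_subset[of _ "{..<r}"])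

lemma sum_I: "(\<And>i. i < r \<Longrightarrow> i \<notin> I \<Longrightarrow> f i = 0) \<Longrightarrow> (\<Sum>i<r. f i) = (\<Sum>i\<in>I. f i)"
  for f :: "nat \<Rightarrow> real"
  by (rule sum.mono_neutral_right) (auto dest: I_less)

text \<open>Outside \<open>I\<close> the slack is constant on \<open>P\<close>, and since the
  hyperplane meets \<open>P\<close> this constant is 0. All sums and products over the indices
  thereby reduce to \<open>I\<close>.\<close>

lemma slack_not_I:
  assumes "i < r" "i \<notin> I" "x \<in> P"
  shows "slack i x = 0"
proof -
  obtain y where "y \<in> P" "slack i y = 0" using facets[OF assms(1)] by (auto simp: P_def slack_def)
  moreover have "v i \<bullet> x = v i \<bullet> y"
    using assms \<open>y \<in> P\<close> unfolding I_def nonconst_idx_def P_def by blast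
  ultimately show ?thesis by (simp add: slack_def)
qed

lemma slack_combination: "slack i ((1 - s) *\<^sub>R x + s *\<^sub>R y) = (1 - s) * slack i x + s * slack i y"
  by (simp add: slack_def inner_simps algebra_simps)

lemma slack_add: "slack i (x + y) = slack i x + v i \<bullet> y"
  by (simp add: slack_def inner_simps)

lemma combination_in_P:
  assumes "x \<in> P" "y \<in> P" "0 \<le> s" "s \<le> 1"
  shows "(1 - s) *\<^sub>R x + s *\<^sub>R y \<in> P"
  using assms by (auto simp: P_iff slack_combination)

lemma P_nonempty: "P \<noteq> {}"
proof -
  have "0 < r" using r by simp
  from facets[OF this] show ?thesis unfolding P_def by blast
qed

text \<open>Midpoints preserve every slack that is positive at one of the two ends, so the indices
  of \<open>I\<close> can be made positive one at a time.\<close>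

lemma exists_interior_point: "\<exists>p\<in>P. \<forall>i\<in>I. slack i p > 0"
proof -
  have "\<exists>p\<in>P. \<forall>i\<in>J. slack i p > 0" if "finite J" "J \<subseteq> I" for J
    using that
  proof (induction J rule: finite_induct)
    case empty
    then show ?case using P_nonempty by blast
  next
    case (insert j J)
    then obtain p where p: "p \<in> P" "\<forall>i\<in>J. slack i p > 0" by auto
    have "j \<in> I" using insert by simp
    then obtain x y where xy: "x \<in> P" "y \<in> P" "slack j x \<noteq> slack j y"
      unfolding I_def nonconst_idx_def P_def slack_def by auto
    moreover have "slack j x \<ge> 0" "slack j y \<ge> 0" using xy I_less[OF \<open>j \<in> I\<close>] by (auto simp: P_iff)
    ultimately have "slack j x > 0 \<or> slack j y > 0" by linarith
    then obtain q where q: "q \<in> P" "slack j q > 0" using xy by blast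
    have "slack i ((1 - 1/2) *\<^sub>R p + (1/2) *\<^sub>R q) > 0" if i: "i \<in> insert j J" for i
    proof -
      have "slack i p \<ge> 0" "slack i q \<ge> 0" using p(1) q(1) insert(4) i I_less by (auto simp: P_iff)
      moreover have "slack i p > 0 \<or> slack i q > 0" using p(2) q(2) i by blast
      ultimately show ?thesis unfolding slack_combination by auto
    qed
    then show ?case using combination_in_P[OF p(1) q(1), of "1/2"] by (intro bexI[of _ "(1 - 1/2) *\<^sub>R p + (1/2) *\<^sub>R q"]) auto
  qed
  from this[OF finite_I order_refl] show ?thesis .
qed

text \<open>Moving along y changes no slack, so a nonzero y would put a whole line into the bounded
  set \<open>P\<close>. The length t is chosen to leave a ball containing \<open>P\<close>.\<close>

lemma kernel_trivial:
  assumes "\<And>i. i < r \<Longrightarrow> v i \<bullet> y = 0"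
  shows "y = 0"
proof (rule ccontr)
  assume y: "y \<noteq> 0"
  obtain p where p: "p \<in> P" using P_nonempty by blast
  obtain D where D: "\<And>x. x \<in> P \<Longrightarrow> norm x \<le> D"
    using compact_imp_bounded[OF compact_P] by (auto simp: bounded_iff P_def)
  define t where "t = (D + norm p + 1) / norm y"
  have "p + t *\<^sub>R y \<in> P" using p assms by (auto simp: P_iff slack_add)
  then have "norm (p + t *\<^sub>R y) \<le> D" by (rule D)
  moreover have "norm (t *\<^sub>R y) \<le> norm (p + t *\<^sub>R y) + norm p"
    using norm_triangle_ineq4[of "p + t *\<^sub>R y" p] by simp
  moreover have "norm (t *\<^sub>R y) = D + norm p + 1"
  proof -
    have "D \<ge> 0" by (rule order_trans[OF norm_ge_zero D[OF p]])
    then have "D + norm p + 1 \<ge> 0" by simp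
    then show ?thesis using y by (simp add: t_def)
  qed
  ultimately show False by linarith
qed

lemma sum_I_inner:
  assumes "\<And>i. i < r \<Longrightarrow> i \<notin> I \<Longrightarrow> v i \<bullet> y = 0"
  shows "(\<Sum>i\<in>I. v i \<bullet> y) = 0"
proof -
  have "(\<Sum>i\<in>I. v i \<bullet> y) = (\<Sum>i<r. v i \<bullet> y)" using sum_I[of "\<lambda>i. v i \<bullet> y"] assms by simp
  also have "\<dots> = 0" unfolding inner_sum_left[symmetric] sum_v by simp
  finally show ?thesis .
qed

lemma potential_eq: "x \<in> P \<Longrightarrow> potential r v a x = exp (entropy x)"
  unfolding potential_def entropy_def exp_sum[OF finite_lessThan] selfpow_def
  by (intro prod.cong refl) (auto simp: slack_def P_iff powr_def mult.commute)

lemma continuous_on_entropy: "continuous_on P entropy"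
proof -
  have "continuous_on P (\<lambda>x. slack i x * ln (slack i x))" if "i < r" for i
  proof -
    have "continuous_on P (slack i)" unfolding slack_def[abs_def] by (intro continuous_intros)
    moreover have "slack i ` P \<subseteq> {0..}" using that by (auto simp: P_iff)
    ultimately show ?thesis by (rule continuous_on_compose2[OF continuous_on_xlnx])
  qed
  then show ?thesis unfolding entropy_def[abs_def] by (intro continuous_on_sum) auto
qed

text \<open>The slope of t ln t at 0 is minus infinity. If the slack j vanished at
  \<open>m0\<close>, a small step towards a point p with positive slack j would gain a multiple of s
  ln s, while convexity limits the change from the other slacks to order s.\<close>

lemma minimizer_slack_pos:
  assumes m0: "m0 \<in> P" "\<And>x. x \<in> P \<Longrightarrow> entropy m0 \<le> entropy x" and j: "j \<in> I"
  shows "slack j m0 > 0"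
proof (rule ccontr)
  assume "\<not> slack j m0 > 0"
  then have j0: "slack j m0 = 0" using m0(1) I_less[OF j] by (auto simp: P_iff dest: order.antisym)
  obtain p where p: "p \<in> P" "slack j p > 0" using exists_interior_point j by blast
  define c where "c = slack j p"
  define K where "K = \<bar>entropy p - entropy m0\<bar> + 1"
  \<comment> \<open>This makes \<open>c * ln s\<close> equal to \<open>- K\<close>, and
    \<open>K\<close> exceeds the entropy difference between p and \<open>m0\<close> by at least
    1.\<close>
  define s where "s = exp (- K / c)"
  have c: "c > 0" and K: "K > 0" using p by (auto simp: c_def K_def)
  have s: "0 < s" "s < 1" using c K by (auto simp: s_def)
  define q where "q = (1 - s) *\<^sub>R m0 + s *\<^sub>R p"
  have "q \<in> P" unfolding q_def using m0(1) p(1) s by (intro combination_in_P) auto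
  have "slack i q * ln (slack i q) \<le> (1 - s) * (slack i m0 * ln (slack i m0)) + s * (slack i p * ln (slack i p))
      + (if i = j then s * (c * ln s) else 0)" if "i < r" for i
  proof (cases "i = j")
    case False
    then show ?thesis unfolding q_def slack_combination
      using xlnx_convex[of "slack i m0" "slack i p" s] m0(1) p(1) s that by (auto simp: P_iff)
  next
    case True
    have "slack i q = s * c" unfolding q_def slack_combination True by (simp add: j0 c_def)
    then show ?thesis using True j0 c s by (simp add: c_def[symmetric] ln_mult algebra_simps)
  qed
  then have "entropy q \<le> (\<Sum>i<r. (1 - s) * (slack i m0 * ln (slack i m0)) + s * (slack i p * ln (slack i p))
      + (if i = j then s * (c * ln s) else 0))"
    unfolding entropy_def by (intro sum_mono) auto
  also have "\<dots> = (1 - s) * entropy m0 + s * entropy p + s * (c * ln s)"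
    using I_less[OF j] by (simp add: sum.distrib entropy_def sum_distrib_left)
  also have "\<dots> = entropy m0 + s * (entropy p - entropy m0 - K)"
    using c by (simp add: s_def algebra_simps)
  also have "\<dots> < entropy m0" using s by (simp add: mult_less_0_iff K_def)
  finally show False using m0(2)[OF \<open>q \<in> P\<close>] by simp
qed

text \<open>All slacks in \<open>I\<close> are positive at \<open>m0\<close>, so short steps along y
  in both directions stay in \<open>P\<close> and the derivative at 0 vanishes. The derivative of t
  ln t is ln t + 1; the contributions of the 1 cancel because the \<open>v i\<close> sum to
  0.\<close>

lemma minimizer_stationary:
  assumes m0: "m0 \<in> P" "\<And>x. x \<in> P \<Longrightarrow> entropy m0 \<le> entropy x"
    and y: "\<And>i. i < r \<Longrightarrow> i \<notin> I \<Longrightarrow> v i \<bullet> y = 0"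
  shows "(\<Sum>i\<in>I. (v i \<bullet> y) * ln (slack i m0)) = 0"
proof -
  have pos: "slack i m0 > 0" if "i \<in> I" for i using minimizer_slack_pos[OF m0 that] .
  define g where "g t = (\<Sum>i\<in>I. (slack i m0 + t * (v i \<bullet> y)) * ln (slack i m0 + t * (v i \<bullet> y)))" for t
  have "\<forall>\<^sub>F t in nhds 0. \<forall>i\<in>I. slack i m0 + t * (v i \<bullet> y) > 0"
    unfolding eventually_ball_finite_distrib[OF finite_I]
  proof
    fix i assume i: "i \<in> I"
    have "((\<lambda>t. slack i m0 + t * (v i \<bullet> y)) \<longlongrightarrow> slack i m0 + 0 * (v i \<bullet> y)) (nhds 0)"
      by (intro tendsto_intros filterlim_ident)
    then show "\<forall>\<^sub>F t in nhds 0. slack i m0 + t * (v i \<bullet> y) > 0"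
      by (rule order_tendstoD(1)) (simp add: pos[OF i])
  qed
  then obtain d where d: "d > 0" "\<And>t i. \<bar>t\<bar> < d \<Longrightarrow> i \<in> I \<Longrightarrow> slack i m0 + t * (v i \<bullet> y) > 0"
    by (auto simp: eventually_nhds_metric dist_real_def)
  have entropy_g: "entropy (m0 + t *\<^sub>R y) = g t \<and> m0 + t *\<^sub>R y \<in> P" if "\<bar>t\<bar> < d" for t
  proof
    have z: "slack i (m0 + t *\<^sub>R y) = 0" if "i < r" "i \<notin> I" for i
      using slack_not_I[OF that m0(1)] y[OF that] by (simp add: slack_add)
    have "slack i (m0 + t *\<^sub>R y) \<ge> 0" if "i < r" for i
      using d(2)[OF \<open>\<bar>t\<bar> < d\<close>, of i] z[OF that] by (cases "i \<in> I") (auto simp: slack_add)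
    then show "m0 + t *\<^sub>R y \<in> P" by (auto simp: P_iff)
    have "entropy (m0 + t *\<^sub>R y) = (\<Sum>i\<in>I. slack i (m0 + t *\<^sub>R y) * ln (slack i (m0 + t *\<^sub>R y)))"
      unfolding entropy_def by (rule sum_I) (simp add: z)
    then show "entropy (m0 + t *\<^sub>R y) = g t" by (simp add: g_def slack_add)
  qed
  have "(g has_real_derivative (\<Sum>i\<in>I. (v i \<bullet> y) * (ln (slack i m0) + 1))) (at 0)"
    unfolding g_def[abs_def]
  proof (rule DERIV_sum)
    fix i assume i: "i \<in> I"
    show "((\<lambda>t. (slack i m0 + t * (v i \<bullet> y)) * ln (slack i m0 + t * (v i \<bullet> y)))
       has_real_derivative (v i \<bullet> y) * (ln (slack i m0) + 1)) (at 0)"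
      using pos[OF i] by (auto intro!: derivative_eq_intros simp: algebra_simps)
  qed
  moreover have "g 0 \<le> g t" if "\<bar>0 - t\<bar> < d" for t
    using entropy_g[of t] entropy_g[of 0] m0(2)[of "m0 + t *\<^sub>R y"] that d(1) by simp
  ultimately have "(\<Sum>i\<in>I. (v i \<bullet> y) * (ln (slack i m0) + 1)) = 0"
    using d(1) by (intro DERIV_local_min) auto
  then show ?thesis using sum_I_inner[OF y] by (simp add: distrib_left sum.distrib)
qed

text \<open>For the inclusion from right to left, y is a multiple of
  \<open>(p + t *\<^sub>R y) - p\<close> with p in the relative interior and t small enough to
  remain in \<open>P\<close>. This description of \<open>L\<close> by integer equations is the form
  used afterwards.\<close>

lemma L_iff: "y \<in> L \<longleftrightarrow> (\<forall>i<r. i \<notin> I \<longrightarrow> v i \<bullet> y = 0)"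
proof
  have "subspace {y. \<forall>i<r. i \<notin> I \<longrightarrow> v i \<bullet> y = 0}" by (auto simp: subspace_def inner_simps)
  moreover have "{y - z |y z. y \<in> P \<and> z \<in> P} \<subseteq> {y. \<forall>i<r. i \<notin> I \<longrightarrow> v i \<bullet> y = 0}"
  proof clarify
    fix y z i assume yz: "y \<in> P" "z \<in> P" "i < r" "i \<notin> I"
    show "v i \<bullet> (y - z) = 0"
      using slack_not_I[OF yz(3,4) yz(1)] slack_not_I[OF yz(3,4) yz(2)] by (simp add: slack_def inner_simps)
  qed
  ultimately have "L \<subseteq> {y. \<forall>i<r. i \<notin> I \<longrightarrow> v i \<bullet> y = 0}"
    unfolding L_def diff_space_def by (intro span_minimal) auto
  then show "y \<in> L \<Longrightarrow> \<forall>i<r. i \<notin> I \<longrightarrow> v i \<bullet> y = 0" by blast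
next
  assume y: "\<forall>i<r. i \<notin> I \<longrightarrow> v i \<bullet> y = 0"
  obtain p where p: "p \<in> P" "\<And>i. i \<in> I \<Longrightarrow> slack i p > 0" using exists_interior_point by blast
  have "\<forall>\<^sub>F t in at_right (0::real). \<forall>i\<in>I. slack i p + t * (v i \<bullet> y) > 0"
    unfolding eventually_ball_finite_distrib[OF finite_I]
  proof
    fix i assume i: "i \<in> I"
    have "((\<lambda>t. slack i p + t * (v i \<bullet> y)) \<longlongrightarrow> slack i p + 0 * (v i \<bullet> y)) (at_right 0)"
      by (intro tendsto_intros)
    then show "\<forall>\<^sub>F t in at_right 0. slack i p + t * (v i \<bullet> y) > 0"
      by (rule order_tendstoD(1)) (simp add: p(2)[OF i])
  qed
  then have "\<forall>\<^sub>F t in at_right (0::real). t > 0 \<and> (\<forall>i\<in>I. slack i p + t * (v i \<bullet> y) > 0)"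
    by (intro eventually_conj eventually_at_right_less)
  then obtain t where t: "t > 0" "\<And>i. i \<in> I \<Longrightarrow> slack i p + t * (v i \<bullet> y) > 0"
    using eventually_happens'[OF trivial_limit_at_right_real] by blast
  have "slack i (p + t *\<^sub>R y) \<ge> 0" if "i < r" for i
    using t(2)[of i] slack_not_I[OF that _ p(1)] y that by (cases "i \<in> I") (auto simp: slack_add)
  then have "p + t *\<^sub>R y \<in> P" by (auto simp: P_iff)
  then have "(p + t *\<^sub>R y) - p \<in> L" unfolding L_def diff_space_def using p(1) by (intro span_base) blast
  then have "(1 / t) *\<^sub>R ((p + t *\<^sub>R y) - p) \<in> L" unfolding L_def diff_space_def by (rule span_scale)
  then show "y \<in> L" using t(1) by simp
qed

text \<open>By stationarity and the vanishing sum of the \<open>v i\<close>, the entropy gap equals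
  the sum of the tangent defects \<open>f i\<close>. These are nonnegative, so all are 0; the
  equality case gives equal slacks, and \<open>kernel_trivial\<close> gives equal points.\<close>

lemma minimizer_unique:
  assumes m0: "m0 \<in> P" "\<And>x. x \<in> P \<Longrightarrow> entropy m0 \<le> entropy x" and x: "x \<in> P" "entropy x \<le> entropy m0"
  shows "x = m0"
proof -
  have pos: "slack i m0 > 0" if "i \<in> I" for i using minimizer_slack_pos[OF m0 that] .
  have sd: "v i \<bullet> (x - m0) = slack i x - slack i m0" for i by (simp add: slack_def inner_simps)
  have y: "v i \<bullet> (x - m0) = 0" if "i < r" "i \<notin> I" for i
    unfolding sd using slack_not_I[OF that] m0(1) x(1) by simp
  have en: "entropy z = (\<Sum>i\<in>I. slack i z * ln (slack i z))" if "z \<in> P" for z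
    unfolding entropy_def using slack_not_I[OF _ _ that] by (intro sum_I) auto
  define f where "f i = (slack i x * ln (slack i x) - slack i x * ln (slack i m0)) - (slack i x - slack i m0)" for i
  have f_nonneg: "f i \<ge> 0" if "i \<in> I" for i
    unfolding f_def using xlnx_tangent[OF pos[OF that], of "slack i x"] x(1) I_less[OF that] by (auto simp: P_iff)
  have "(\<Sum>i\<in>I. f i) = entropy x - entropy m0 - (\<Sum>i\<in>I. (v i \<bullet> (x - m0)) * ln (slack i m0)) - (\<Sum>i\<in>I. v i \<bullet> (x - m0))"
    unfolding en[OF m0(1)] en[OF x(1)] sd f_def sum_subtractf[symmetric]
    by (intro sum.cong refl) (simp add: algebra_simps)
  also have "(\<Sum>i\<in>I. (v i \<bullet> (x - m0)) * ln (slack i m0)) = 0"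
    by (rule minimizer_stationary[OF m0 y])
  also have "(\<Sum>i\<in>I. v i \<bullet> (x - m0)) = 0" by (rule sum_I_inner[OF y])
  also have "entropy x - entropy m0 - 0 - 0 \<le> 0" using x(2) by simp
  finally have "(\<Sum>i\<in>I. f i) = 0" using f_nonneg by (intro antisym sum_nonneg) auto
  then have f0: "f i = 0" if "i \<in> I" for i
    using that f_nonneg finite_I by (simp add: sum_nonneg_eq_0_iff)
  have "v i \<bullet> (x - m0) = 0" if "i < r" for i
  proof (cases "i \<in> I")
    case True
    have "slack i x = slack i m0"
      by (rule xlnx_tangent_eq[OF pos[OF True]]) (use f0[OF True] x(1) that in \<open>auto simp: f_def P_iff\<close>)
    then show ?thesis by (simp add: sd)
  qed (use y that in blast)
  from kernel_trivial[OF this] show ?thesis by simp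
qed

text \<open>Existence comes from compactness. Together with uniqueness it resolves the definite
  description in \<open>min_point\<close>.\<close>

lemma m_minimizer: "m \<in> P" "\<And>x. x \<in> P \<Longrightarrow> entropy m \<le> entropy x"
proof -
  obtain m0 where m0: "m0 \<in> P" "\<And>x. x \<in> P \<Longrightarrow> entropy m0 \<le> entropy x"
    using continuous_attains_inf[OF _ P_nonempty continuous_on_entropy] compact_P by (auto simp: P_def)
  have "m = m0" unfolding m_def min_point_def P_def[symmetric]
  proof (rule the_equality)
    show "m0 \<in> P \<and> (\<forall>x\<in>P. potential r v a m0 \<le> potential r v a x)"
      using m0 by (simp add: potential_eq)
    fix m' assume m': "m' \<in> P \<and> (\<forall>x\<in>P. potential r v a m' \<le> potential r v a x)"
    then have "entropy m' \<le> entropy m0" using m0(1) by (auto simp: potential_eq)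
    then show "m' = m0" using minimizer_unique[OF m0] m' by blast
  qed
  then show "m \<in> P" "\<And>x. x \<in> P \<Longrightarrow> entropy m \<le> entropy x" using m0 by auto
qed

lemma slack_m_pos: "i \<in> I \<Longrightarrow> slack i m > 0"
  using minimizer_slack_pos[OF m_minimizer] .

lemma m_stationary: "y \<in> L \<Longrightarrow> (\<Sum>i\<in>I. (v i \<bullet> y) * ln (slack i m)) = 0"
  using minimizer_stationary[OF m_minimizer] L_iff by blast

section \<open>The limit theorem\<close>

definition supp where "supp k = pm_support r v (\<lambda>i. int k * a i)"
definition lattice where "lattice = {x \<in> L. \<forall>j. x $ j \<in> \<int>}"
definition count where "count k i x = nat \<lfloor>v i \<bullet> x + of_int (int k * a i)\<rfloor>"
definition weight where "weight k x = (\<Prod>i\<in>I. pois_ratio (real k * slack i m) (count k i x))"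
definition Q where "Q x = (\<Sum>i\<in>I. (v i \<bullet> x)\<^sup>2 / slack i m)"

lemma Q_eq: "Qform r v a = Q"
  by (rule ext) (simp add: Qform_def Q_def I_def m_def slack_def)

lemma subspace_L: "subspace L"
  by (simp add: L_def diff_space_def)

section \<open>Support points, weights and expectations\<close>

lemma inner_int: "i < r \<Longrightarrow> (\<And>j. x $ j \<in> \<int>) \<Longrightarrow> v i \<bullet> x \<in> \<int>"
  unfolding inner_vec_def using int_v by (auto intro!: Ints_sum)

lemma supp_iff: "x \<in> supp k \<longleftrightarrow> (\<forall>i<r. v i \<bullet> x + of_int (int k * a i) \<ge> 0) \<and> (\<forall>j. x $ j \<in> \<int>)"
  by (auto simp: supp_def pm_support_def polyhedron_def)

lemma supp_scaled:
  assumes "k \<ge> 1" "x \<in> supp k"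
  shows "(1 / real k) *\<^sub>R x \<in> P"
proof -
  have "slack i ((1 / real k) *\<^sub>R x) \<ge> 0" if "i < r" for i
  proof -
    have "slack i ((1 / real k) *\<^sub>R x) = (v i \<bullet> x + of_int (int k * a i)) / real k"
      using assms(1) by (simp add: slack_def field_simps)
    then show ?thesis using assms that by (simp add: supp_iff)
  qed
  then show ?thesis by (simp add: P_iff)
qed

lemma slack_scaled: "k \<ge> 1 \<Longrightarrow> v i \<bullet> x + of_int (int k * a i) = real k * slack i ((1 / real k) *\<^sub>R x)"
  by (simp add: slack_def field_simps)

lemma finite_supp:
  assumes "k \<ge> 1"
  shows "finite (supp k)"
proof -
  obtain D where D: "\<And>x. x \<in> P \<Longrightarrow> norm x \<le> D"
    using compact_imp_bounded[OF compact_P] by (auto simp: bounded_iff P_def)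
  have "norm x \<le> real k * D" if "x \<in> supp k" for x
    using D[OF supp_scaled[OF assms that]] assms by (simp add: field_simps)
  then have "bounded (supp k)" by (auto simp: bounded_iff)
  from finite_integer_points[OF this] show ?thesis
    by (rule finite_subset[rotated]) (auto simp: supp_iff)
qed

lemma count_supp:
  assumes "x \<in> supp k" "i < r"
  shows "real (count k i x) = v i \<bullet> x + of_int (int k * a i)"
proof -
  have "v i \<bullet> x + of_int (int k * a i) \<in> \<int>"
    using inner_int[OF assms(2)] assms(1) by (auto simp: supp_iff)
  then obtain N where N: "v i \<bullet> x + of_int (int k * a i) = of_int N" by (rule Ints_cases)
  moreover have "N \<ge> 0" using assms N[symmetric] by (simp add: supp_iff flip: of_int_0_le_iff[where 'a = real])
  ultimately show ?thesis unfolding count_def N by simp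
qed

lemma supp_diff_L:
  assumes "k \<ge> 1" "x \<in> supp k" "y \<in> P"
  shows "x - real k *\<^sub>R y \<in> L"
  unfolding L_iff
proof (intro allI impI)
  fix i assume i: "i < r" "i \<notin> I"
  have "v i \<bullet> x + of_int (int k * a i) = 0"
    unfolding slack_scaled[OF assms(1)] using slack_not_I[OF i supp_scaled[OF assms(1,2)]] by simp
  moreover have "v i \<bullet> y + of_int (a i) = 0" using slack_not_I[OF i assms(3)] by (simp add: slack_def)
  then have "real k * (v i \<bullet> y + of_int (a i)) = 0" by simp
  ultimately show "v i \<bullet> (x - real k *\<^sub>R y) = 0" by (simp add: inner_simps algebra_simps)
qed

lemma weight_pos: "k \<ge> 1 \<Longrightarrow> weight k x > 0"
  unfolding weight_def by (intro prod_pos ballI pois_ratio_pos) (simp add: slack_m_pos)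

text \<open>Stationarity of the minimizer makes the exponential tilt constant on the support, so the
  multinomial weights are proportional to products of Poisson probabilities.\<close>
lemma prod_mean_powers_const:
  assumes k: "k \<ge> 1" and x: "x \<in> supp k" "x' \<in> supp k"
  shows "(\<Prod>i\<in>I. (real k * slack i m) ^ count k i x) = (\<Prod>i\<in>I. (real k * slack i m) ^ count k i x')"
proof -
  have pos: "real k * slack i m > 0" if "i \<in> I" for i using k slack_m_pos[OF that] by simp
  have ex: "(\<Prod>i\<in>I. (real k * slack i m) ^ count k i y) = exp (\<Sum>i\<in>I. real (count k i y) * ln (real k * slack i m))" for y
    unfolding exp_sum[OF finite_I] by (intro prod.cong refl) (simp add: pos exp_of_nat_mult)
  obtain p where p: "p \<in> P" using P_nonempty by blast
  have "(x - real k *\<^sub>R p) - (x' - real k *\<^sub>R p) \<in> L"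
    using x p k by (intro subspace_diff[OF subspace_L] supp_diff_L)
  then have xx: "x - x' \<in> L" by simp
  have "(\<Sum>i\<in>I. real (count k i x) * ln (real k * slack i m)) - (\<Sum>i\<in>I. real (count k i x') * ln (real k * slack i m))
     = (\<Sum>i\<in>I. (v i \<bullet> (x - x')) * ln (real k) + (v i \<bullet> (x - x')) * ln (slack i m))"
    unfolding sum_subtractf[symmetric]
  proof (intro sum.cong refl)
    fix i assume i: "i \<in> I"
    have "ln (real k * slack i m) = ln (real k) + ln (slack i m)"
      using k slack_m_pos[OF i] by (simp add: ln_mult)
    then show "real (count k i x) * ln (real k * slack i m) - real (count k i x') * ln (real k * slack i m) =
       (v i \<bullet> (x - x')) * ln (real k) + (v i \<bullet> (x - x')) * ln (slack i m)"
      using count_supp[OF x(1) I_less[OF i]] count_supp[OF x(2) I_less[OF i]]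
      by (simp add: inner_simps algebra_simps)
  qed
  \<comment> \<open>The two sums vanish for different reasons: the coefficient of
    \<open>ln (real k)\<close> because the \<open>v i\<close> sum to 0, the other one by
    stationarity at \<open>m\<close>.\<close>
  also have "\<dots> = (\<Sum>i\<in>I. v i \<bullet> (x - x')) * ln (real k) + (\<Sum>i\<in>I. (v i \<bullet> (x - x')) * ln (slack i m))"
    by (simp add: sum.distrib sum_distrib_right)
  also have "\<dots> = 0" using sum_I_inner[of "x - x'"] m_stationary[OF xx] xx by (simp add: L_iff)
  finally show ?thesis unfolding ex by simp
qed

text \<open>The constant may depend on \<open>k\<close> but not on the point, so it cancels against
  the normalization. Indices outside \<open>I\<close> have count 0 and contribute 0! = 1.\<close>

lemma pm_weight_eq:
  assumes k: "k \<ge> 1"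
  shows "\<exists>c>0. \<forall>x\<in>supp k. pm_weight r v (\<lambda>i. int k * a i) x = c * weight k x"
proof -
  obtain x0 where x0: "x0 \<in> supp k" using support_nonempty[OF k] by (auto simp: supp_def)
  define \<mu> where "\<mu> i = real k * slack i m" for i
  have pos: "\<mu> i > 0" if "i \<in> I" for i using k slack_m_pos[OF that] by (simp add: \<mu>_def)
  define K :: real where "K = (\<Prod>i\<in>I. fact (nat \<lfloor>\<mu> i\<rfloor>) / \<mu> i ^ nat \<lfloor>\<mu> i\<rfloor>)"
  define T where "T = (\<Prod>i\<in>I. \<mu> i ^ count k i x0)"
  define f :: real where "f = fact (nat (\<Sum>i<r. int k * a i))"
  have K: "K > 0" unfolding K_def by (intro prod_pos) (auto intro!: divide_pos_pos simp: pos)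
  have T: "T > 0" unfolding T_def by (intro prod_pos) (auto simp: pos)
  have "pm_weight r v (\<lambda>i. int k * a i) x = f / (T * K) * weight k x" if x: "x \<in> supp k" for x
  proof -
    have "count k i x = 0" if "i < r" "i \<notin> I" for i
    proof -
      have "real (count k i x) = 0"
        unfolding count_supp[OF x that(1)] slack_scaled[OF k] using slack_not_I[OF that supp_scaled[OF k x]] by simp
      then show ?thesis by simp
    qed
    then have "(\<Prod>i<r. fact (count k i x) :: real) = (\<Prod>i\<in>I. fact (count k i x))"
      by (intro prod.mono_neutral_right) (auto dest: I_less)
    then have "pm_weight r v (\<lambda>i. int k * a i) x = f / (\<Prod>i\<in>I. fact (count k i x))"
      unfolding pm_weight_def f_def count_def[symmetric] by simp
    moreover have "weight k x = T * K / (\<Prod>i\<in>I. fact (count k i x))"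
    proof -
      have "weight k x = (\<Prod>i\<in>I. \<mu> i ^ count k i x) * K / (\<Prod>i\<in>I. fact (count k i x))"
        unfolding weight_def pois_ratio_def \<mu>_def[symmetric] K_def prod.distrib[symmetric] prod_dividef[symmetric]
        by (intro prod.cong refl) simp
      then show ?thesis unfolding T_def \<mu>_def using prod_mean_powers_const[OF k x x0] by simp
    qed
    ultimately show ?thesis using T K by simp
  qed
  moreover have "f / (T * K) > 0" using T K by (simp add: f_def)
  ultimately show ?thesis by blast
qed

lemma expectation_pm_pmf:
  fixes g :: "real^'n \<Rightarrow> 'b::{banach, second_countable_topology}"
  assumes k: "k \<ge> 1"
  shows "measure_pmf.expectation (pm_pmf r v (\<lambda>i. int k * a i)) g =
     (1 / (\<Sum>x\<in>supp k. weight k x)) *\<^sub>R (\<Sum>x\<in>supp k. weight k x *\<^sub>R g x)"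
proof -
  let ?b = "\<lambda>i. int k * a i"
  have fin: "finite (supp k)" by (rule finite_supp[OF k])
  have ne: "supp k \<noteq> {}" using support_nonempty[OF k] by (simp add: supp_def)
  obtain c where c: "c > 0" "\<And>x. x \<in> supp k \<Longrightarrow> pm_weight r v ?b x = c * weight k x"
    using pm_weight_eq[OF k] by blast
  define W where "W = (\<Sum>x\<in>supp k. weight k x)"
  have W: "W > 0" unfolding W_def using fin ne weight_pos[OF k] by (intro sum_pos) auto
  define p where "p x = (if x \<in> supp k then weight k x / W else 0)" for x
  have "(\<lambda>x. if x \<in> pm_support r v ?b then pm_weight r v ?b x / (\<Sum>y\<in>pm_support r v ?b. pm_weight r v ?b y) else 0) = p"
    unfolding supp_def[symmetric] p_def W_def using c
    by (auto simp: fun_eq_iff sum_distrib_left[symmetric] cong: sum.cong)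
  then have emb: "pm_pmf r v ?b = embed_pmf p" by (simp add: pm_pmf_def)
  have p_nonneg: "p x \<ge> 0" for x using W weight_pos[OF k] by (simp add: p_def less_imp_le)
  have "(\<integral>\<^sup>+x. ennreal (p x) \<partial>count_space UNIV) = (\<Sum>x\<in>supp k. ennreal (p x))"
    by (rule nn_integral_count_space'[OF fin]) (auto simp: p_def)
  also have "\<dots> = ennreal (\<Sum>x\<in>supp k. p x)" using p_nonneg by simp
  also have "(\<Sum>x\<in>supp k. p x) = 1" using W by (simp add: p_def W_def flip: sum_divide_distrib)
  finally have "(\<integral>\<^sup>+x. ennreal (p x) \<partial>count_space UNIV) = 1" by simp
  then have pmf: "pmf (pm_pmf r v ?b) x = p x" for x
    unfolding emb using p_nonneg by (intro pmf_embed_pmf) auto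
  have "measure_pmf.expectation (pm_pmf r v ?b) g = (\<Sum>x\<in>supp k. pmf (pm_pmf r v ?b) x *\<^sub>R g x)"
    by (rule integral_measure_pmf[OF fin]) (auto simp: set_pmf_iff pmf p_def split: if_splits)
  also have "\<dots> = (1 / W) *\<^sub>R (\<Sum>x\<in>supp k. weight k x *\<^sub>R g x)"
    unfolding scaleR_sum_right by (intro sum.cong refl) (simp add: pmf p_def)
  finally show ?thesis by (simp add: W_def)
qed

text \<open>The right-hand side is a norm on \<open>L\<close>, compared with the Euclidean one by
  compactness of the unit sphere. It turns separate tails of the counts into decay in the
  norm.\<close>

lemma linear_forms_bound: "\<exists>c>0. \<forall>y\<in>L. c * norm y \<le> (\<Sum>i\<in>I. \<bar>v i \<bullet> y\<bar> / sqrt (slack i m))"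
proof -
  \<comment> \<open>The forms outside \<open>I\<close> are included so that \<open>h\<close>
    vanishes only at 0 on the whole space; on \<open>L\<close> they contribute nothing.\<close>
  define \<mu> where "\<mu> i = (if i \<in> I then 1 / sqrt (slack i m) else 1)" for i
  have \<mu>: "\<mu> i > 0" for i by (simp add: \<mu>_def slack_m_pos)
  define h where "h y = (\<Sum>i<r. \<bar>v i \<bullet> y\<bar> * \<mu> i)" for y
  have "continuous_on (sphere 0 1) h" unfolding h_def[abs_def] by (intro continuous_intros)
  moreover have "sphere 0 1 \<noteq> ({} :: (real^'n) set)" by simp
  ultimately obtain y0 where y0: "y0 \<in> sphere 0 1" "\<And>y. y \<in> sphere 0 1 \<Longrightarrow> h y0 \<le> h y"
    using continuous_attains_inf[OF compact_sphere] by metis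
  have "h y0 > 0"
  proof (rule ccontr)
    assume "\<not> h y0 > 0"
    moreover have nn: "0 \<le> \<bar>v i \<bullet> y0\<bar> * \<mu> i" for i using \<mu>[of i] by simp
    then have "h y0 \<ge> 0" unfolding h_def by (intro sum_nonneg)
    ultimately have "h y0 = 0" by simp
    then have "\<forall>i\<in>{..<r}. \<bar>v i \<bullet> y0\<bar> * \<mu> i = 0"
      unfolding h_def sum_nonneg_eq_0_iff[OF finite_lessThan nn] .
    then have "v i \<bullet> y0 = 0" if "i < r" for i using \<mu>[of i] that by auto
    from kernel_trivial[OF this] y0(1) show False by simp
  qed
  moreover have "h y0 * norm y \<le> (\<Sum>i\<in>I. \<bar>v i \<bullet> y\<bar> / sqrt (slack i m))" if y: "y \<in> L" for y
  proof -
    have "h y0 * norm y \<le> h y"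
    proof (cases "y = 0")
      case False
      have "h y = norm y * h (y /\<^sub>R norm y)"
        unfolding h_def sum_distrib_left using False
        by (intro sum.cong refl) (simp add: abs_mult)
      moreover have "h y0 \<le> h (y /\<^sub>R norm y)" using False by (intro y0(2)) simp
      ultimately show ?thesis using mult_left_mono[of "h y0" "h (y /\<^sub>R norm y)" "norm y"] by (simp add: mult.commute)
    qed (simp add: h_def)
    also have "h y = (\<Sum>i\<in>I. \<bar>v i \<bullet> y\<bar> * \<mu> i)"
      unfolding h_def using y by (intro sum_I) (auto simp: L_iff)
    also have "\<dots> = (\<Sum>i\<in>I. \<bar>v i \<bullet> y\<bar> / sqrt (slack i m))"
      by (intro sum.cong refl) (simp add: \<mu>_def)
    finally show ?thesis .
  qed
  ultimately show ?thesis by blast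
qed

lemma count_deviation:
  assumes k: "k \<ge> 1" and x: "x \<in> supp k" and i: "i \<in> I"
  shows "(real (count k i x) - real k * slack i m) / sqrt (real k * slack i m)
     = (v i \<bullet> ((x - real k *\<^sub>R m) /\<^sub>R sqrt (real k))) / sqrt (slack i m)"
proof -
  have "real (count k i x) - real k * slack i m = v i \<bullet> (x - real k *\<^sub>R m)"
    unfolding count_supp[OF x I_less[OF i]] by (simp add: slack_def inner_simps algebra_simps)
  then show ?thesis by (simp add: real_sqrt_mult divide_inverse)
qed

lemma weight_bound:
  "\<exists>K\<ge>1. \<exists>c>0. \<exists>C. \<forall>k\<ge>K. \<forall>x\<in>supp k. weight k x \<le> C * exp (- c * norm ((x - real k *\<^sub>R m) /\<^sub>R sqrt (real k)))"
proof -
  obtain c where c: "c > 0" "\<And>y. y \<in> L \<Longrightarrow> c * norm y \<le> (\<Sum>i\<in>I. \<bar>v i \<bullet> y\<bar> / sqrt (slack i m))"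
    using linear_forms_bound by blast
  \<comment> \<open>Beyond this threshold every mean \<open>real k * slack i m\<close> is at least
    1, as the Poisson tail bounds require.\<close>
  define K0 where "K0 = nat \<lceil>\<Sum>i\<in>I. 1 / slack i m\<rceil>"
  have K0: "1 / slack i m \<le> real K0" if "i \<in> I" for i
  proof -
    have "1 / slack i m \<le> (\<Sum>i\<in>I. 1 / slack i m)"
      using that finite_I by (intro member_le_sum) (auto simp: slack_m_pos less_imp_le)
    also have "\<dots> \<le> real K0" unfolding K0_def by (rule real_nat_ceiling_ge)
    finally show ?thesis .
  qed
  define K where "K = max 1 K0"
  have "weight k x \<le> (exp 2 ^ card I) * exp (- (c / 2) * norm ((x - real k *\<^sub>R m) /\<^sub>R sqrt (real k)))"
    if k: "k \<ge> K" and x: "x \<in> supp k" for k x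
  proof -
    have k1: "k \<ge> 1" using k by (simp add: K_def)
    define y where "y = (x - real k *\<^sub>R m) /\<^sub>R sqrt (real k)"
    have y: "y \<in> L" unfolding y_def
      by (intro subspace_scale[OF subspace_L] supp_diff_L k1 x m_minimizer)
    have "weight k x \<le> (\<Prod>i\<in>I. exp 2 * exp (- (\<bar>v i \<bullet> y\<bar> / sqrt (slack i m)) / 2))"
      unfolding weight_def
    proof (intro prod_mono conjI)
      fix i assume i: "i \<in> I"
      have "1 / slack i m \<le> real k" using K0[OF i] k by (simp add: K_def)
      then have \<mu>: "real k * slack i m \<ge> 1" using slack_m_pos[OF i] by (simp add: field_simps)
      then show "0 \<le> pois_ratio (real k * slack i m) (count k i x)"
        by (intro less_imp_le pois_ratio_pos) simp
      have "\<bar>real (count k i x) - real k * slack i m\<bar> / sqrt (real k * slack i m) = \<bar>v i \<bullet> y\<bar> / sqrt (slack i m)"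
        using arg_cong[OF count_deviation[OF k1 x i], of abs] \<mu> slack_m_pos[OF i] unfolding y_def[symmetric]
        by (simp only: abs_divide real_sqrt_abs2 abs_of_nonneg real_sqrt_ge_zero less_imp_le)
      then show "pois_ratio (real k * slack i m) (count k i x) \<le> exp 2 * exp (- (\<bar>v i \<bullet> y\<bar> / sqrt (slack i m)) / 2)"
        using pois_ratio_bound[OF \<mu>, of "count k i x"] by (simp only:)
    qed
    also have "\<dots> = exp 2 ^ card I * exp (- (\<Sum>i\<in>I. \<bar>v i \<bullet> y\<bar> / sqrt (slack i m)) / 2)"
      unfolding prod.distrib exp_sum[OF finite_I, symmetric] prod_constant
      by (simp only: sum_negf[symmetric] sum_divide_distrib)
    also have "\<dots> \<le> exp 2 ^ card I * exp (- (c / 2) * norm y)"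
      using c(2)[OF y] by (intro mult_left_mono) auto
    finally show ?thesis by (simp only: y_def)
  qed
  moreover have "K \<ge> 1" "c / 2 > 0" using c by (auto simp: K_def)
  ultimately show ?thesis by blast
qed

text \<open>Points within order sqrt k of \<open>k\<close> times \<open>m\<close> satisfy the
  inequalities of \<open>I\<close> eventually, since those slacks at \<open>m\<close> grow linearly
  in \<open>k\<close>; outside \<open>I\<close> equality holds exactly along \<open>L\<close>. Thus
  truncation to the support does not affect the pointwise limit.\<close>

lemma lattice_point_eventually_supp:
  assumes K: "K \<ge> 1" and x0: "x0 \<in> supp 1"
    and l: "\<And>k. l k \<in> lattice"
    and y: "(\<lambda>k. (l k + real (k + K) *\<^sub>R x0 - real (k + K) *\<^sub>R m) /\<^sub>R sqrt (real (k + K))) \<longlonglongrightarrow> u"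
  shows "\<forall>\<^sub>F k in sequentially. l k + real (k + K) *\<^sub>R x0 \<in> supp (k + K)"
proof -
  define x where "x k = l k + real (k + K) *\<^sub>R x0" for k
  define Y where "Y k = (x k - real (k + K) *\<^sub>R m) /\<^sub>R sqrt (real (k + K))" for k
  have Y: "Y \<longlonglongrightarrow> u" using y by (simp add: Y_def[abs_def] x_def)
  have x0P: "x0 \<in> P" "\<And>j. x0 $ j \<in> \<int>" using x0 supp_scaled[of 1 x0] by (auto simp: supp_iff)
  have "\<forall>\<^sub>F k in sequentially. v i \<bullet> x k + of_int (int (k + K) * a i) \<ge> 0" if i: "i < r" for i
  proof (cases "i \<in> I")
    case False
    have "v i \<bullet> x k + of_int (int (k + K) * a i) = v i \<bullet> l k + real (k + K) * slack i x0" for k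
      by (simp add: x_def slack_def inner_simps algebra_simps)
    moreover have "slack i x0 = 0" by (rule slack_not_I[OF i False x0P(1)])
    moreover have "v i \<bullet> l k = 0" for k using l[of k] i False by (auto simp: lattice_def L_iff)
    ultimately show ?thesis by simp
  next
    case True
    \<comment> \<open>Dividing the constraint by sqrt (k + K) leaves a convergent term plus a
      positive multiple of sqrt (k + K).\<close>
    have eq: "v i \<bullet> x k + of_int (int (k + K) * a i) = sqrt (real (k + K)) * (v i \<bullet> Y k + slack i m * sqrt (real (k + K)))" for k
    proof -
      define w where "w = sqrt (real (k + K))"
      have w2: "real (k + K) = w * w" unfolding w_def by simp
      have "w > 0" using K by (simp add: w_def)
      then have xk: "x k = w *\<^sub>R Y k + (w * w) *\<^sub>R m"
        unfolding Y_def w_def[symmetric] w2 by simp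
      have "real_of_int (int (k + K) * a i) = (w * w) * of_int (a i)" unfolding w2[symmetric] by simp
      then show ?thesis unfolding w_def[symmetric] xk
        by (simp add: slack_def inner_simps algebra_simps)
    qed
    have "filterlim (\<lambda>k. real (k + K)) at_top sequentially"
      by (rule filterlim_compose[OF filterlim_real_sequentially filterlim_add_const_nat_at_top])
    then have "filterlim (\<lambda>k. slack i m * sqrt (real (k + K))) at_top sequentially"
      using slack_m_pos[OF True] by (intro filterlim_tendsto_pos_mult_at_top[OF tendsto_const] filterlim_compose[OF sqrt_at_top])
    then have "filterlim (\<lambda>k. v i \<bullet> Y k + slack i m * sqrt (real (k + K))) at_top sequentially"
      by (rule filterlim_tendsto_add_at_top[OF tendsto_inner[OF tendsto_const Y]])
    then have "\<forall>\<^sub>F k in sequentially. v i \<bullet> Y k + slack i m * sqrt (real (k + K)) \<ge> 0"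
      by (auto simp: filterlim_at_top)
    then show ?thesis unfolding eq by eventually_elim (rule mult_nonneg_nonneg[OF real_sqrt_ge_zero[OF of_nat_0_le_iff]])
  qed
  then have "\<forall>\<^sub>F k in sequentially. \<forall>i\<in>{..<r}. v i \<bullet> x k + of_int (int (k + K) * a i) \<ge> 0"
    unfolding eventually_ball_finite_distrib[OF finite_lessThan] by blast
  then show ?thesis
  proof eventually_elim
    case (elim k)
    have "x k $ j \<in> \<int>" for j using l[of k] x0P(2) by (simp add: x_def lattice_def)
    then show ?case using elim by (simp add: supp_iff x_def)
  qed
qed

lemma weight_local_limit:
  assumes K: "K \<ge> 1" and x: "\<forall>\<^sub>F k in sequentially. x k \<in> supp (k + K)"
    and y: "(\<lambda>k. (x k - real (k + K) *\<^sub>R m) /\<^sub>R sqrt (real (k + K))) \<longlonglongrightarrow> u"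
  shows "(\<lambda>k. weight (k + K) (x k)) \<longlonglongrightarrow> exp (- Q u / 2)"
proof -
  have "(\<lambda>k. pois_ratio (real (k + K) * slack i m) (count (k + K) i (x k)))
      \<longlonglongrightarrow> exp (- (v i \<bullet> u / sqrt (slack i m))\<^sup>2 / 2)" if i: "i \<in> I" for i
  proof (rule pois_ratio_local_limit)
    have "filterlim (\<lambda>k. real (k + K)) at_top sequentially"
      by (rule filterlim_compose[OF filterlim_real_sequentially filterlim_add_const_nat_at_top])
    then show "filterlim (\<lambda>k. real (k + K) * slack i m) at_top sequentially"
      using slack_m_pos[OF i] by (rule filterlim_at_top_mult_tendsto_pos[OF tendsto_const, rotated])
    have "(\<lambda>k. (v i \<bullet> ((x k - real (k + K) *\<^sub>R m) /\<^sub>R sqrt (real (k + K)))) / sqrt (slack i m))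
        \<longlonglongrightarrow> v i \<bullet> u / sqrt (slack i m)"
      using slack_m_pos[OF i] by (intro tendsto_intros y) simp
    moreover have "\<forall>\<^sub>F k in sequentially.
       (v i \<bullet> ((x k - real (k + K) *\<^sub>R m) /\<^sub>R sqrt (real (k + K)))) / sqrt (slack i m) =
       (real (count (k + K) i (x k)) - real (k + K) * slack i m) / sqrt (real (k + K) * slack i m)"
      using x by eventually_elim (rule count_deviation[symmetric], use K i in auto)
    ultimately show "(\<lambda>k. (real (count (k + K) i (x k)) - real (k + K) * slack i m) / sqrt (real (k + K) * slack i m))
        \<longlonglongrightarrow> v i \<bullet> u / sqrt (slack i m)"
      by (rule Lim_transform_eventually)
  qed
  then have "(\<lambda>k. weight (k + K) (x k)) \<longlonglongrightarrow> (\<Prod>i\<in>I. exp (- (v i \<bullet> u / sqrt (slack i m))\<^sup>2 / 2))"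
    unfolding weight_def by (rule tendsto_prod)
  also have "(\<Prod>i\<in>I. exp (- (v i \<bullet> u / sqrt (slack i m))\<^sup>2 / 2)) = exp (- Q u / 2)"
    unfolding exp_sum[OF finite_I, symmetric] Q_def sum_negf[symmetric] sum_divide_distrib
    by (intro arg_cong[of _ _ exp] sum.cong refl) (simp add: power_divide slack_m_pos less_imp_le)
  finally show ?thesis .
qed

section \<open>The Gaussian limit measure\<close>

lemma Q_measurable[measurable]: "Q \<in> borel_measurable borel"
  unfolding Q_def[abs_def] by measurable

lemma integrable_gauss: "integrable (subspace_lebesgue L) (\<lambda>x. exp (- Q x / 2))"
proof -
  obtain c where c: "c > 0" "\<And>y. y \<in> L \<Longrightarrow> c * norm y \<le> (\<Sum>i\<in>I. \<bar>v i \<bullet> y\<bar> / sqrt (slack i m))"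
    using linear_forms_bound by blast
  have Q_ge: "exp (- Q y / 2) \<le> exp (real (card I) / 2) * exp (- c * norm y)" if y: "y \<in> L" for y
  proof -
    \<comment> \<open>From (t - 1)^2 \<ge> 0: a quadratic dominates a linear function up to 1/2,
      which reduces Gaussian integrability to that of the exponential of the norm.\<close>
    have "\<bar>v i \<bullet> y\<bar> / sqrt (slack i m) - 1/2 \<le> ((v i \<bullet> y)\<^sup>2 / slack i m) / 2" if i: "i \<in> I" for i
    proof -
      define t where "t = \<bar>v i \<bullet> y\<bar> / sqrt (slack i m)"
      have "(v i \<bullet> y)\<^sup>2 / slack i m = t\<^sup>2"
        using slack_m_pos[OF i] by (simp add: t_def power_divide)
      moreover have "0 \<le> (t - 1)\<^sup>2" by simp
      ultimately show ?thesis unfolding t_def[symmetric] by (simp add: power2_diff)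
    qed
    then have "(\<Sum>i\<in>I. \<bar>v i \<bullet> y\<bar> / sqrt (slack i m) - 1/2) \<le> (\<Sum>i\<in>I. ((v i \<bullet> y)\<^sup>2 / slack i m) / 2)"
      by (rule sum_mono)
    also have "\<dots> = Q y / 2" by (simp add: Q_def sum_divide_distrib)
    finally have "c * norm y - real (card I) / 2 \<le> Q y / 2" using c(2)[OF y] by (simp add: sum_subtractf)
    then show ?thesis unfolding exp_add[symmetric] by simp
  qed
  show ?thesis
  proof (rule Bochner_Integration.integrable_bound)
    show "integrable (subspace_lebesgue L) (\<lambda>y. exp (real (card I) / 2) * exp (- c * norm y))"
      using integrable_exp_norm_subspace[OF subspace_L c(1)] by (rule integrable_mult_right)
    show "AE y in subspace_lebesgue L. norm (exp (- Q y / 2)) \<le> norm (exp (real (card I) / 2) * exp (- c * norm y))"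
      using AE_subspace_lebesgue[OF subspace_L] by eventually_elim (use Q_ge in \<open>simp add: abs_mult\<close>)
  qed measurable
qed

definition Z where "Z = (\<integral>x. exp (- Q x / 2) \<partial>subspace_lebesgue L)"

lemma Z_pos: "Z > 0"
proof -
  have "Z \<noteq> 0"
  proof
    assume "Z = 0"
    then have "AE x in subspace_lebesgue L. exp (- Q x / 2) = 0"
      unfolding Z_def by (subst (asm) integral_nonneg_eq_0_iff_AE[OF integrable_gauss]) auto
    then have "AE x in subspace_lebesgue L. \<not> True" by eventually_elim simp
    then have "emeasure (subspace_lebesgue L) UNIV = 0"
      using emeasure_eq_0_AE[of "\<lambda>_. True" "subspace_lebesgue L"] by simp
    then show False using subspace_lebesgue_nonzero[OF subspace_L] by simp
  qed
  moreover have "Z \<ge> 0" unfolding Z_def by (intro Bochner_Integration.integral_nonneg) simp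
  ultimately show ?thesis by simp
qed

text \<open>Reflection preserves the measure on \<open>L\<close> (scale -1, for which the Jacobian
  factor is 1) and \<open>Q\<close> is even, so the integral equals its own negative.\<close>

lemma gauss_mean_zero: "(\<integral>x. exp (- Q x / 2) *\<^sub>R x \<partial>subspace_lebesgue L) = 0"
proof -
  let ?M = "subspace_lebesgue L"
  let ?J = "\<integral>x. exp (- Q x / 2) *\<^sub>R x \<partial>?M"
  have M: "?M = distr ?M borel (\<lambda>x. - x)"
    using subspace_lebesgue_affine[OF subspace_L subspace_0[OF subspace_L], of "-1"] by (simp add: density_1)
  have "?J = (\<integral>x. exp (- Q x / 2) *\<^sub>R x \<partial>distr ?M borel (\<lambda>x. - x))" using M by simp
  also have "\<dots> = (\<integral>x. exp (- Q (- x) / 2) *\<^sub>R (- x) \<partial>?M)"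
    by (rule integral_distr) measurable
  also have "\<dots> = - ?J" by (simp add: Q_def)
  finally have "?J = - ?J" .
  then have "?J + ?J = 0" by (simp only: eq_neg_iff_add_eq_0)
  then have "2 *\<^sub>R ?J = 0" by (simp only: scaleR_2)
  then show ?thesis unfolding scaleR_eq_0_iff by simp
qed

lemma gauss_limit_integral:
  fixes f :: "real^'n \<Rightarrow> real"
  assumes [measurable]: "f \<in> borel_measurable borel"
  shows "integral\<^sup>L (gauss_limit r v a) f = (1 / Z) * (\<integral>x. exp (- Q x / 2) * f x \<partial>subspace_lebesgue L)"
proof -
  have "gauss_limit r v a = density (subspace_lebesgue L) (\<lambda>x. ennreal (exp (- Q x / 2) / Z))"
    by (simp add: gauss_limit_def Let_def Q_eq L_def P_def Z_def)
  then have "integral\<^sup>L (gauss_limit r v a) f = (\<integral>x. (exp (- Q x / 2) / Z) *\<^sub>R f x \<partial>subspace_lebesgue L)"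
    using Z_pos by (simp only:) (rule integral_density, auto simp: less_imp_le)
  also have "\<dots> = (\<integral>x. (1 / Z) * (exp (- Q x / 2) * f x) \<partial>subspace_lebesgue L)" by simp
  finally show ?thesis by (simp only: integral_mult_right_zero)
qed

section \<open>Convergence of expectations\<close>

lemma lattice_properties:
  "0 \<in> lattice" "x \<in> lattice \<Longrightarrow> y \<in> lattice \<Longrightarrow> x - y \<in> lattice"
  "bounded S \<Longrightarrow> finite (lattice \<inter> S)" "span lattice = L"
proof -
  show "0 \<in> lattice" using subspace_L by (simp add: lattice_def subspace_0)
  show "x \<in> lattice \<Longrightarrow> y \<in> lattice \<Longrightarrow> x - y \<in> lattice"
    using subspace_L by (simp add: lattice_def subspace_diff)
  show "bounded S \<Longrightarrow> finite (lattice \<inter> S)"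
    by (rule finite_subset[OF _ finite_integer_points[of S]]) (auto simp: lattice_def)
  \<comment> \<open>\<open>L\<close> is the common kernel of integer vectors, the form needed for
    its integer points to span it.\<close>
  have "L = {x. \<forall>w\<in>v ` {i. i < r \<and> i \<notin> I}. w \<bullet> x = 0}" using L_iff by auto
  moreover have "span {x \<in> {x. \<forall>w\<in>v ` {i. i < r \<and> i \<notin> I}. w \<bullet> x = 0}. \<forall>j. x $ j \<in> \<int>}
      = {x. \<forall>w\<in>v ` {i. i < r \<and> i \<notin> I}. w \<bullet> x = 0}"
    by (rule span_integer_points) (use int_v Ints_subset_Rats in auto)
  ultimately show "span lattice = L" unfolding lattice_def by (simp only:)
qed

text \<open>Subtracting \<open>real (k + K) *\<^sub>R x0\<close>, with \<open>x0\<close> an integer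
  point of \<open>P\<close>, moves all supports into the one set \<open>lattice\<close>. The shift
  by \<open>K\<close> makes the weight bound valid for every index, as the Riemann sum lemma
  asks.\<close>

lemma weighted_sum_limit:
  fixes g :: "nat \<Rightarrow> real^'n \<Rightarrow> 'b::{banach, second_countable_topology}"
  assumes U: "U \<in> sets borel" "bounded U"
    and tile: "\<And>z. z \<in> L \<Longrightarrow> finite {l \<in> lattice. z - l \<in> U} \<and> card {l \<in> lattice. z - l \<in> U} = \<kappa>" "\<kappa> > 0"
    and K: "K \<ge> 1" and c: "c > 0"
    and w: "\<And>k x. k \<ge> K \<Longrightarrow> x \<in> supp k \<Longrightarrow> weight k x \<le> C * exp (- c * norm ((x - real k *\<^sub>R m) /\<^sub>R sqrt (real k)))"
    and g: "\<And>k y. norm (g k y) \<le> B * (1 + norm y)"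
    and lim: "\<And>y u. y \<longlonglongrightarrow> u \<Longrightarrow> (\<lambda>k. g k (y k)) \<longlonglongrightarrow> G u"
    and G[measurable]: "G \<in> borel_measurable borel"
  shows "(\<lambda>k. (measure (subspace_lebesgue L) U / sqrt (real (k + K)) ^ dim L) *\<^sub>R
      (\<Sum>x\<in>supp (k + K). weight (k + K) x *\<^sub>R g (k + K) ((x - real (k + K) *\<^sub>R m) /\<^sub>R sqrt (real (k + K)))))
    \<longlonglongrightarrow> real \<kappa> *\<^sub>R (\<integral>u. exp (- Q u / 2) *\<^sub>R G u \<partial>subspace_lebesgue L)"
proof -
  obtain x0 where x0: "x0 \<in> supp 1" using support_nonempty[of 1] by (auto simp: supp_def)
  then have x0P: "x0 \<in> P" "\<And>j. x0 $ j \<in> \<int>" using supp_scaled[of 1 x0] by (auto simp: supp_iff)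
  define X where "X k l = l + real (k + K) *\<^sub>R x0" for k and l :: "real^'n"
  define s where "s k = real (k + K) *\<^sub>R m - real (k + K) *\<^sub>R x0" for k
  define \<sigma> where "\<sigma> k = sqrt (real (k + K))" for k
  \<comment> \<open>The value 0 off the support extends the summand to the whole lattice without
    changing the sum or the bound.\<close>
  define F where "F k l = (if X k l \<in> supp (k + K)
     then weight (k + K) (X k l) *\<^sub>R g (k + K) ((X k l - real (k + K) *\<^sub>R m) /\<^sub>R \<sigma> k) else 0)" for k l
  define S where "S k = (\<lambda>x. x - real (k + K) *\<^sub>R x0) ` supp (k + K)" for k
  have Xs: "l - s k = X k l - real (k + K) *\<^sub>R m" for k l by (simp add: X_def s_def)
  have k1: "k + K \<ge> 1" for k using K by simp
  have \<sigma>_top: "filterlim \<sigma> at_top sequentially"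
    unfolding \<sigma>_def[abs_def]
    by (rule filterlim_compose[OF sqrt_at_top filterlim_compose[OF filterlim_real_sequentially filterlim_add_const_nat_at_top]])
  have B: "B \<ge> 0" using order_trans[OF norm_ge_zero g[of 0 0]] by simp
  have w_nonneg: "0 \<le> weight k x" if "k \<ge> 1" for k x using weight_pos[OF that] by (rule less_imp_le)
  have C: "C \<ge> 0"
  proof -
    obtain x where x: "x \<in> supp K" using support_nonempty[OF K] by (auto simp: supp_def)
    have "0 \<le> C * exp (- c * norm ((x - real K *\<^sub>R m) /\<^sub>R sqrt (real K)))"
      by (rule order_trans[OF w_nonneg[OF K] w[OF order_refl x]])
    then show ?thesis by (simp add: zero_le_mult_iff)
  qed
  have "(\<lambda>k. (measure (subspace_lebesgue L) U / \<sigma> k ^ dim L) *\<^sub>R (\<Sum>l\<in>S k. F k l))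
     \<longlonglongrightarrow> real \<kappa> *\<^sub>R (\<integral>u. exp (- Q u / 2) *\<^sub>R G u \<partial>subspace_lebesgue L)"
  proof (rule lattice_riemann_sum[OF subspace_L U, of lattice])
    show "lattice \<subseteq> L" by (auto simp: lattice_def)
    show "finite {l \<in> lattice. z - l \<in> U} \<and> card {l \<in> lattice. z - l \<in> U} = \<kappa>" if "z \<in> L" for z
      by (rule tile(1)[OF that])
    show "\<kappa> > 0" by (rule tile(2))
    show "\<sigma> k \<ge> 1" for k using K by (simp add: \<sigma>_def)
    show "filterlim \<sigma> at_top sequentially" by (rule \<sigma>_top)
    show "s k \<in> L" for k
    proof -
      have "m - x0 \<in> L" unfolding L_def diff_space_def
        using m_minimizer(1) x0P(1) by (intro span_base) (auto simp: P_def)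
      then have "real (k + K) *\<^sub>R (m - x0) \<in> L" by (rule subspace_scale[OF subspace_L])
      then show ?thesis by (simp only: s_def scaleR_right_diff_distrib)
    qed
    show "finite (S k)" for k unfolding S_def by (intro finite_imageI finite_supp k1)
    show "S k \<subseteq> lattice" for k
    proof -
      have "x - real (k + K) *\<^sub>R x0 \<in> lattice" if "x \<in> supp (k + K)" for x
        using supp_diff_L[OF k1 that x0P(1)] that x0P(2) by (simp add: lattice_def supp_iff)
      then show ?thesis by (auto simp: S_def)
    qed
    show "F k l = 0" if "l \<in> lattice" "l \<notin> S k" for k l
    proof -
      have "X k l \<notin> supp (k + K)"
      proof
        assume "X k l \<in> supp (k + K)"
        then have "X k l - real (k + K) *\<^sub>R x0 \<in> S k" unfolding S_def by (rule imageI)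
        then show False using that(2) by (simp add: X_def)
      qed
      then show ?thesis by (simp add: F_def)
    qed
    show "c / 2 > 0" using c by simp
    show "norm (F k l) \<le> (C * B * (1 + 2 / c)) * exp (- (c / 2) * norm ((l - s k) /\<^sub>R \<sigma> k))" for k l
    proof (cases "X k l \<in> supp (k + K)")
      case True
      define y where "y = (X k l - real (k + K) *\<^sub>R m) /\<^sub>R \<sigma> k"
      \<comment> \<open>Half of the exponential decay is spent on absorbing the linear growth of
        \<open>g\<close>; hence the rate \<open>c / 2\<close> and the constant
        \<open>1 + 2 / c\<close>.\<close>
      have "(1 + 2 / c) * (1 + (c / 2) * norm y) = 1 + norm y + (2 / c + (c / 2) * norm y)"
        using c by (simp add: distrib_left distrib_right)
      moreover have "0 \<le> 2 / c + (c / 2) * norm y" using c by simp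
      ultimately have "1 + norm y \<le> (1 + 2 / c) * (1 + (c / 2) * norm y)" by linarith
      also have "\<dots> \<le> (1 + 2 / c) * exp ((c / 2) * norm y)"
        using c by (intro mult_left_mono exp_ge_add_one_self) auto
      finally have 1: "1 + norm y \<le> (1 + 2 / c) * exp ((c / 2) * norm y)" .
      have "norm (F k l) = weight (k + K) (X k l) * norm (g (k + K) y)"
        using True w_nonneg[OF k1] by (simp add: F_def y_def)
      also have "\<dots> \<le> (C * exp (- c * norm y)) * (B * (1 + norm y))"
      proof (rule mult_mono)
        show "weight (k + K) (X k l) \<le> C * exp (- c * norm y)"
          using w[OF _ True] by (simp add: y_def \<sigma>_def)
        show "norm (g (k + K) y) \<le> B * (1 + norm y)" by (rule g)
      qed (use C in auto)
      also have "\<dots> \<le> (C * exp (- c * norm y)) * (B * ((1 + 2 / c) * exp ((c / 2) * norm y)))"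
        using C B 1 by (intro mult_left_mono) auto
      also have "\<dots> = (C * B * (1 + 2 / c)) * (exp (- c * norm y) * exp ((c / 2) * norm y))"
        by (simp only: mult_ac)
      also have "exp (- c * norm y) * exp ((c / 2) * norm y) = exp (- (c / 2) * norm y)"
        unfolding exp_add[symmetric] by (rule arg_cong[of _ _ exp]) (simp add: field_simps)
      finally show ?thesis by (simp only: y_def Xs)
    next
      case False
      then show ?thesis using C B c by (simp add: F_def)
    qed
    show "(\<lambda>k. F k (l k)) \<longlonglongrightarrow> exp (- Q u / 2) *\<^sub>R G u"
      if u: "u \<in> L" and l: "\<And>k. l k \<in> lattice" and y: "(\<lambda>k. (l k - s k) /\<^sub>R \<sigma> k) \<longlonglongrightarrow> u" for u l
    proof -
      define Y where "Y k = (X k (l k) - real (k + K) *\<^sub>R m) /\<^sub>R sqrt (real (k + K))" for k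
      have Y: "Y \<longlonglongrightarrow> u" using y by (simp only: Y_def[abs_def] Xs \<sigma>_def)
      have ev: "\<forall>\<^sub>F k in sequentially. X k (l k) \<in> supp (k + K)"
        using lattice_point_eventually_supp[OF K x0, where l = l and u = u, OF l] Y by (simp only: X_def Y_def[abs_def])
      have W: "(\<lambda>k. weight (k + K) (X k (l k))) \<longlonglongrightarrow> exp (- Q u / 2)"
        using weight_local_limit[OF K ev] Y by (simp only: Y_def[abs_def])
      \<comment> \<open>The assumption on \<open>g\<close> pairs index k with the k-th point,
        whereas \<open>Y k\<close> goes with \<open>g (k + K)\<close>; delaying \<open>Y\<close> by
        \<open>K\<close> aligns the two.\<close>
      have "(\<lambda>k. Y (k - K)) \<longlonglongrightarrow> u" by (rule LIMSEQ_offset[of _ K]) (use Y in simp)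
      from LIMSEQ_ignore_initial_segment[OF lim[OF this], of K]
      have "(\<lambda>k. g (k + K) (Y k)) \<longlonglongrightarrow> G u" by simp
      from tendsto_scaleR[OF W this]
      have "(\<lambda>k. weight (k + K) (X k (l k)) *\<^sub>R g (k + K) (Y k)) \<longlonglongrightarrow> exp (- Q u / 2) *\<^sub>R G u" .
      moreover have "\<forall>\<^sub>F k in sequentially. weight (k + K) (X k (l k)) *\<^sub>R g (k + K) (Y k) = F k (l k)"
        using ev by eventually_elim (simp add: F_def Y_def \<sigma>_def)
      ultimately show ?thesis by (rule Lim_transform_eventually)
    qed
    show "(\<lambda>u. exp (- Q u / 2) *\<^sub>R G u) \<in> borel_measurable borel" by measurable
  qed
  moreover have "(\<Sum>l\<in>S k. F k l) =
      (\<Sum>x\<in>supp (k + K). weight (k + K) x *\<^sub>R g (k + K) ((x - real (k + K) *\<^sub>R m) /\<^sub>R sqrt (real (k + K))))" for k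
    unfolding S_def
    by (subst sum.reindex) (auto simp: F_def X_def \<sigma>_def inj_on_def intro!: sum.cong)
  ultimately show ?thesis by (simp only: \<sigma>_def)
qed

text \<open>An expectation is a quotient of two weighted sums with the same prefactor. Taking
  \<open>g\<close> constantly 1 gives the limit of the denominator, and the cell volume, the power
  of sqrt k and \<kappa> cancel.\<close>

lemma expectation_limit:
  fixes g :: "nat \<Rightarrow> real^'n \<Rightarrow> 'b::{banach, second_countable_topology}"
  assumes g: "\<And>k y. norm (g k y) \<le> B * (1 + norm y)"
    and lim: "\<And>y u. y \<longlonglongrightarrow> u \<Longrightarrow> (\<lambda>k. g k (y k)) \<longlonglongrightarrow> G u"
    and G: "G \<in> borel_measurable borel"
  shows "(\<lambda>k. measure_pmf.expectation (pm_pmf r v (\<lambda>i. int k * a i)) (\<lambda>x. g k ((x - real k *\<^sub>R m) /\<^sub>R sqrt (real k))))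
    \<longlonglongrightarrow> (1 / Z) *\<^sub>R (\<integral>u. exp (- Q u / 2) *\<^sub>R G u \<partial>subspace_lebesgue L)"
proof -
  let ?J = "\<integral>u. exp (- Q u / 2) *\<^sub>R G u \<partial>subspace_lebesgue L"
  obtain U \<kappa> where U: "U \<in> sets borel" "bounded U" "(\<kappa>::nat) > 0"
    "\<And>z. z \<in> L \<Longrightarrow> finite {l \<in> lattice. z - l \<in> U} \<and> card {l \<in> lattice. z - l \<in> U} = \<kappa>"
  proof (rule lattice_multi_tile)
    show "0 \<in> lattice" by (rule lattice_properties)
    show "x - y \<in> lattice" if "x \<in> lattice" "y \<in> lattice" for x y
      using that by (rule lattice_properties)
    show "finite (lattice \<inter> S)" if "bounded S" for S using that by (rule lattice_properties)
    show "span lattice = L" by (rule lattice_properties)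
    fix U and \<kappa> :: nat
    assume "U \<in> sets borel" "bounded U" "\<kappa> > 0"
      "\<And>z. z \<in> L \<Longrightarrow> finite {l \<in> lattice. z - l \<in> U} \<and> card {l \<in> lattice. z - l \<in> U} = \<kappa>"
    then show thesis by (rule that)
  qed
  obtain K c C where K: "K \<ge> 1" "c > 0"
    "\<And>k x. k \<ge> K \<Longrightarrow> x \<in> supp k \<Longrightarrow> weight k x \<le> C * exp (- c * norm ((x - real k *\<^sub>R m) /\<^sub>R sqrt (real k)))"
    using weight_bound by blast
  define coef where "coef k = measure (subspace_lebesgue L) U / sqrt (real (k + K)) ^ dim L" for k
  define W where "W k = (\<Sum>x\<in>supp (k + K). weight (k + K) x)" for k
  define N where "N k = (\<Sum>x\<in>supp (k + K). weight (k + K) x *\<^sub>R g (k + K) ((x - real (k + K) *\<^sub>R m) /\<^sub>R sqrt (real (k + K))))" for k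
  have limW: "(\<lambda>k. coef k * W k) \<longlonglongrightarrow> real \<kappa> * Z"
    using weighted_sum_limit[OF U(1,2,4,3) K, of "\<lambda>_ _. 1::real" 1 "\<lambda>_. 1"]
    by (simp add: coef_def W_def Z_def)
  have limN: "(\<lambda>k. coef k *\<^sub>R N k) \<longlonglongrightarrow> real \<kappa> *\<^sub>R ?J"
    unfolding coef_def N_def by (rule weighted_sum_limit[OF U(1,2,4,3) K g lim G])
  have cancel: "inverse (x * y) *\<^sub>R (x *\<^sub>R b) = (1 / y) *\<^sub>R b" if "x \<noteq> 0" for x y and b :: 'b
    using that by (simp only: scaleR_scaleR) (simp add: field_simps)
  have \<kappa>Z: "real \<kappa> * Z > 0" using U(3) Z_pos by simp
  have "(\<lambda>k. inverse (coef k * W k) *\<^sub>R (coef k *\<^sub>R N k)) \<longlonglongrightarrow> inverse (real \<kappa> * Z) *\<^sub>R (real \<kappa> *\<^sub>R ?J)"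
    by (rule tendsto_scaleR[OF tendsto_inverse[OF limW] limN]) (use \<kappa>Z in linarith)
  also have "inverse (real \<kappa> * Z) *\<^sub>R (real \<kappa> *\<^sub>R ?J) = (1 / Z) *\<^sub>R ?J"
    by (rule cancel) (use U(3) in simp)
  finally have 1: "(\<lambda>k. inverse (coef k * W k) *\<^sub>R (coef k *\<^sub>R N k)) \<longlonglongrightarrow> (1 / Z) *\<^sub>R ?J" .
  \<comment> \<open>The positive limit itself shows that \<open>coef k\<close> is eventually
    nonzero, which is what the cancellation needs from the cell volume.\<close>
  have "\<forall>\<^sub>F k in sequentially. coef k * W k > 0" using limW \<kappa>Z by (rule order_tendstoD)
  then have "\<forall>\<^sub>F k in sequentially. inverse (coef k * W k) *\<^sub>R (coef k *\<^sub>R N k) =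
    measure_pmf.expectation (pm_pmf r v (\<lambda>i. int (k + K) * a i))
      (\<lambda>x. g (k + K) ((x - real (k + K) *\<^sub>R m) /\<^sub>R sqrt (real (k + K))))"
  proof eventually_elim
    case (elim k)
    then have "coef k \<noteq> 0" by auto
    then have "inverse (coef k * W k) *\<^sub>R (coef k *\<^sub>R N k) = (1 / W k) *\<^sub>R N k"
      by (rule cancel)
    then show ?case using K(1) by (subst expectation_pm_pmf) (simp_all add: W_def N_def)
  qed
  from Lim_transform_eventually[OF 1 this] show ?thesis by (rule LIMSEQ_offset)
qed

text \<open>The recentring is moved into the test function: \<open>c k\<close> is the mean of the
  variable centred at \<open>real k *\<^sub>R m\<close>, and it tends to 0 by
  \<open>expectation_limit\<close> for the identity and the symmetry of the limit.\<close>

lemma weak_limit: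
  "weak_conv_meas
     (\<lambda>k. measure_pmf (map_pmf
        (\<lambda>x. (1 / sqrt (real k)) *\<^sub>R
              (x - measure_pmf.expectation (pm_pmf r v (\<lambda>i. int k * a i)) (\<lambda>y. y)))
        (pm_pmf r v (\<lambda>i. int k * a i))))
     (gauss_limit r v a)"
  unfolding weak_conv_meas_def
proof (intro allI impI)
  fix f :: "real^'n \<Rightarrow> real" assume f: "continuous_on UNIV f" "bounded (range f)"
  let ?E = "\<lambda>k. measure_pmf.expectation (pm_pmf r v (\<lambda>i. int k * a i)) :: (real^'n \<Rightarrow> real^'n) \<Rightarrow> real^'n"
  define c where "c k = ?E k (\<lambda>x. (x - real k *\<^sub>R m) /\<^sub>R sqrt (real k))" for k
  have "(\<lambda>k. ?E k (\<lambda>x. (x - real k *\<^sub>R m) /\<^sub>R sqrt (real k))) \<longlonglongrightarrow>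
      (1 / Z) *\<^sub>R (\<integral>u. exp (- Q u / 2) *\<^sub>R u \<partial>subspace_lebesgue L)"
    by (rule expectation_limit[where B = 1]) simp_all
  then have c0: "c \<longlonglongrightarrow> 0" unfolding gauss_mean_zero by (simp add: c_def[abs_def])
  have c_eq: "c k = (1 / sqrt (real k)) *\<^sub>R (?E k (\<lambda>x. x) - real k *\<^sub>R m)" if k: "k \<ge> 1" for k
  proof -
    define W where "W = (\<Sum>x\<in>supp k. weight k x)"
    have "supp k \<noteq> {}" using support_nonempty[OF k] by (simp add: supp_def)
    then have W: "W > 0" unfolding W_def using finite_supp[OF k] weight_pos[OF k] by (intro sum_pos) auto
    have "c k = (1 / W) *\<^sub>R (\<Sum>x\<in>supp k. weight k x *\<^sub>R ((x - real k *\<^sub>R m) /\<^sub>R sqrt (real k)))"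
      unfolding c_def expectation_pm_pmf[OF k] W_def ..
    also have "(\<Sum>x\<in>supp k. weight k x *\<^sub>R ((x - real k *\<^sub>R m) /\<^sub>R sqrt (real k))) =
       (1 / sqrt (real k)) *\<^sub>R ((\<Sum>x\<in>supp k. weight k x *\<^sub>R x) - W *\<^sub>R (real k *\<^sub>R m))"
      unfolding W_def scaleR_sum_left sum_subtractf[symmetric] scaleR_sum_right
      by (intro sum.cong refl) (simp add: scaleR_right_diff_distrib divide_inverse mult_ac)
    also have "(1 / W) *\<^sub>R \<dots> = (1 / sqrt (real k)) *\<^sub>R ((1 / W) *\<^sub>R (\<Sum>x\<in>supp k. weight k x *\<^sub>R x) - real k *\<^sub>R m)"
      using W by (simp add: scaleR_right_diff_distrib mult_ac)
    finally show ?thesis unfolding expectation_pm_pmf[OF k] W_def .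
  qed
  obtain B where B: "\<And>x. \<bar>f x\<bar> \<le> B" using f(2) by (auto simp: bounded_iff)
  have cont: "isCont f x" for x using f(1) by (simp add: continuous_on_eq_continuous_at)
  have fm[measurable]: "f \<in> borel_measurable borel" by (rule borel_measurable_continuous_onI[OF f(1)])
  \<comment> \<open>Subtracting \<open>c k\<close> replaces the centre
    \<open>real k *\<^sub>R m\<close> by the true mean; continuity of \<open>f\<close> and
    \<open>c\<close> tending to 0 give the limit \<open>f u\<close> along any sequence converging to
    u.\<close>
  define g where "g k y = f (y - c k)" for k y
  have "(\<lambda>k. measure_pmf.expectation (pm_pmf r v (\<lambda>i. int k * a i)) (\<lambda>x. g k ((x - real k *\<^sub>R m) /\<^sub>R sqrt (real k))))
    \<longlonglongrightarrow> (1 / Z) *\<^sub>R (\<integral>u. exp (- Q u / 2) *\<^sub>R f u \<partial>subspace_lebesgue L)"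
  proof (rule expectation_limit[where B = B])
    fix k and y :: "real^'n"
    have "B \<ge> 0" by (rule order_trans[OF abs_ge_zero B[of 0]])
    then have "B \<le> B * (1 + norm y)" by (simp add: algebra_simps)
    then show "norm (g k y) \<le> B * (1 + norm y)" using B[of "y - c k"] by (simp add: g_def)
  next
    fix y u assume y: "(y :: nat \<Rightarrow> real^'n) \<longlonglongrightarrow> u"
    have "(\<lambda>k. y k - c k) \<longlonglongrightarrow> u" using tendsto_diff[OF y c0] by simp
    then show "(\<lambda>k. g k (y k)) \<longlonglongrightarrow> f u" unfolding g_def by (rule isCont_tendsto_compose[OF cont])
  qed measurable
  also have "(1 / Z) *\<^sub>R (\<integral>u. exp (- Q u / 2) *\<^sub>R f u \<partial>subspace_lebesgue L) = integral\<^sup>L (gauss_limit r v a) f"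
    by (simp add: gauss_limit_integral)
  finally have lim: "(\<lambda>k. measure_pmf.expectation (pm_pmf r v (\<lambda>i. int k * a i)) (\<lambda>x. g k ((x - real k *\<^sub>R m) /\<^sub>R sqrt (real k))))
    \<longlonglongrightarrow> integral\<^sup>L (gauss_limit r v a) f" .
  \<comment> \<open>The identification holds for k at least 1 only, since \<open>c_eq\<close> uses
    the nonempty finite support; the index 0 does not affect the limit.\<close>
  have "\<forall>\<^sub>F k in sequentially.
     measure_pmf.expectation (pm_pmf r v (\<lambda>i. int k * a i)) (\<lambda>x. g k ((x - real k *\<^sub>R m) /\<^sub>R sqrt (real k))) =
     integral\<^sup>L (measure_pmf (map_pmf (\<lambda>x. (1 / sqrt (real k)) *\<^sub>R (x - ?E k (\<lambda>y. y))) (pm_pmf r v (\<lambda>i. int k * a i)))) f"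
    using eventually_ge_at_top[of 1]
  proof eventually_elim
    case (elim k)
    have "(x - real k *\<^sub>R m) /\<^sub>R sqrt (real k) - c k = (1 / sqrt (real k)) *\<^sub>R (x - ?E k (\<lambda>y. y))" for x
      unfolding c_eq[OF elim] by (simp add: scaleR_right_diff_distrib divide_inverse)
    then show ?case by (simp only: integral_map_pmf g_def)
  qed
  from Lim_transform_eventually[OF lim this]
  show "(\<lambda>k. integral\<^sup>L (measure_pmf (map_pmf (\<lambda>x. (1 / sqrt (real k)) *\<^sub>R (x - ?E k (\<lambda>y. y))) (pm_pmf r v (\<lambda>i. int k * a i)))) f)
     \<longlonglongrightarrow> integral\<^sup>L (gauss_limit r v a) f" .
qed

end

theorem mainTheorem1:
  fixes r :: nat and v :: "nat \<Rightarrow> real^'n" and a :: "nat \<Rightarrow> int"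
  assumes "r \<ge> 1"
    and "\<forall>i<r. \<forall>j. v i $ j \<in> \<int>"
    and "(\<Sum>i<r. v i) = 0"
    and "compact (polyhedron r v a)"
    and "\<forall>i<r. \<exists>x\<in>polyhedron r v a. v i \<bullet> x + of_int (a i) = 0"
    and "\<forall>k\<ge>1. pm_support r v (\<lambda>i. int k * a i) \<noteq> {}"
  shows "weak_conv_meas
     (\<lambda>k. measure_pmf (map_pmf
        (\<lambda>x. (1 / sqrt (real k)) *\<^sub>R
              (x - measure_pmf.expectation (pm_pmf r v (\<lambda>i. int k * a i)) (\<lambda>y. y)))
        (pm_pmf r v (\<lambda>i. int k * a i))))
     (gauss_limit r v a)"
proof -
  interpret polyhedral_multinomial r v a
    using assms by unfold_locales auto
  show ?thesis by (rule weak_limit)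
qed

end
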